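(* There exists a polynomial-time algorithm which, given a permutation graph $G$ and integers $b$ and $w$, decides whether $G$ has a black-and-white coloring with $b$ black vertices and $w$ white vertices, i.e., whether there exist disjoint sets $B, W \subseteq V(G)$ with $|B| = b$ and $|W| = w$ such that no vertex of $B$ is adjacent in $G$ to any vertex of $W$.
   Context: Graphs are finite, simple and undirected. A black-and-white coloring of a graph $G=(V,E)$ with $b$ black and $w$ white vertices colors $b$ vertices black and $w$ other vertices white (the remaining vertices stay uncolored) such that no black vertex is adjacent to any white vertex. Permutation diagram and permutation graph: consider two horizontal lines $L_1$ and $L_2$, one above the other. Label $n$ distinct points on $L_1$ and $n$ distinct points on $L_2$, in each case with the labels $\{1,\dots,n\}$ (in arbitrary order, each label used once on each line). For each $k \in \{1,\dots,n\}$ connect the point with label $k$ on $L_1$ to the point with label $k$ on $L_2$ by a straight line segment. This is a permutation diagram. The corresponding permutation graph with vertex set $\{1,\dots,n\}$ is the intersection graph of the line segments: two distinct vertices are adjacent if and only if their line segments intersect. A graph is a permutation graph if it is (isomorphic to) the graph of some permutation diagram. Polynomial time means time polynomial in the size of the input. *)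

theory Defs
  imports
    "HOL-Analysis.Analysis"
    "HOL-Computational_Algebra.Polynomial"
    "HOL-Library.Log_Nat"
begin

section \<open>Graphs\<close>

type_synonym 'a graph = "'a set \<times> 'a set set"

definition simple_graph :: "'a graph \<Rightarrow> bool" where
  "simple_graph = (\<lambda>(V, E). finite V \<and> E \<subseteq> {{u, v} | u v. u \<in> V \<and> v \<in> V \<and> u \<noteq> v})"

definition graph_iso :: "'a graph \<Rightarrow> 'b graph \<Rightarrow> bool" where
  "graph_iso = (\<lambda>(V, E) (V', E'). \<exists>f. bij_betw f V V' \<and>
     (\<forall>u\<in>V. \<forall>v\<in>V. {u, v} \<in> E \<longleftrightarrow> {f u, f v} \<in> E'))"

definition has_bw_coloring :: "'a graph \<Rightarrow> int \<Rightarrow> int \<Rightarrow> bool" where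
  "has_bw_coloring = (\<lambda>(V, E) b w. \<exists>B W. B \<subseteq> V \<and> W \<subseteq> V \<and> B \<inter> W = {} \<and>
     int (card B) = b \<and> int (card W) = w \<and> (\<forall>x\<in>B. \<forall>y\<in>W. {x, y} \<notin> E))"

section \<open>Permutation diagrams and permutation graphs\<close>

text \<open>The lines are \<open>y = 1\<close> and \<open>y = 0\<close> in the plane; \<open>p k\<close> and \<open>q k\<close> are the abscissae of the
  points with label \<open>k\<close> on the upper and on the lower line.\<close>

definition permutation_diagram :: "nat \<Rightarrow> (nat \<Rightarrow> real) \<Rightarrow> (nat \<Rightarrow> real) \<Rightarrow> bool" where
  "permutation_diagram n p q \<longleftrightarrow> inj_on p {1..n} \<and> inj_on q {1..n}"

definition diagram_segment :: "(nat \<Rightarrow> real) \<Rightarrow> (nat \<Rightarrow> real) \<Rightarrow> nat \<Rightarrow> (real \<times> real) set" where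
  "diagram_segment p q k = closed_segment (p k, 1) (q k, 0)"

definition diagram_graph :: "nat \<Rightarrow> (nat \<Rightarrow> real) \<Rightarrow> (nat \<Rightarrow> real) \<Rightarrow> nat graph" where
  "diagram_graph n p q = ({1..n},
     {{i, j} | i j. i \<in> {1..n} \<and> j \<in> {1..n} \<and> i \<noteq> j \<and>
        diagram_segment p q i \<inter> diagram_segment p q j \<noteq> {}})"

definition permutation_graph :: "'a graph \<Rightarrow> bool" where
  "permutation_graph G \<longleftrightarrow> simple_graph G \<and>
     (\<exists>n p q. permutation_diagram n p q \<and> graph_iso G (diagram_graph n p q))"

section \<open>Polynomial-time algorithms\<close>

text \<open>The machine model is the random access machine with integer registers, indirect addressing,
  addition and subtraction (but no multiplication or shifts) and unit cost per instruction, as in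
  Papadimitriou, \<^emph>\<open>Computational Complexity\<close>, Section 2.6, with structured control flow in
  place of jumps. As one instruction lengthens the largest register content by at most one bit
  (apart from the constants occurring in the program), polynomial time on this machine coincides
  with polynomial time on Turing machines.\<close>

datatype ram_com =
    Skip
  | Const nat int
  | Add nat nat nat
  | Sub nat nat nat
  | Load nat nat
  | Store nat nat
  | Seq ram_com ram_com
  | IfPos nat ram_com ram_com
  | WhilePos nat ram_com

type_synonym ram_state = "nat \<Rightarrow> int"

text \<open>\<open>ram_exec c s t s'\<close>: started in \<open>s\<close>, program \<open>c\<close> halts after exactly \<open>t\<close> steps in \<open>s'\<close>.
  A negative indirect address refers to register 0.\<close>

inductive ram_exec :: "ram_com \<Rightarrow> ram_state \<Rightarrow> nat \<Rightarrow> ram_state \<Rightarrow> bool" where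
  Skip: "ram_exec Skip s 1 s"
| Const: "ram_exec (Const r c) s 1 (s(r := c))"
| Add: "ram_exec (Add r i j) s 1 (s(r := s i + s j))"
| Sub: "ram_exec (Sub r i j) s 1 (s(r := s i - s j))"
| Load: "ram_exec (Load r i) s 1 (s(r := s (nat (s i))))"
| Store: "ram_exec (Store i r) s 1 (s(nat (s i) := s r))"
| Seq: "ram_exec c1 s t1 s' \<Longrightarrow> ram_exec c2 s' t2 s'' \<Longrightarrow> ram_exec (Seq c1 c2) s (t1 + t2) s''"
| IfTrue: "s i > 0 \<Longrightarrow> ram_exec c1 s t s' \<Longrightarrow> ram_exec (IfPos i c1 c2) s (1 + t) s'"
| IfFalse: "\<not> s i > 0 \<Longrightarrow> ram_exec c2 s t s' \<Longrightarrow> ram_exec (IfPos i c1 c2) s (1 + t) s'"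
| WhileFalse: "\<not> s i > 0 \<Longrightarrow> ram_exec (WhilePos i c) s 1 s"
| WhileTrue: "s i > 0 \<Longrightarrow> ram_exec c s t1 s' \<Longrightarrow> ram_exec (WhilePos i c) s' t2 s'' \<Longrightarrow>
    ram_exec (WhilePos i c) s (1 + t1 + t2) s''"

definition ram_input :: "int list \<Rightarrow> ram_state" where
  "ram_input xs = (\<lambda>r. if r < length xs then xs ! r else 0)"

text \<open>Length of the binary representation; the additional unit per entry accounts for the sign.\<close>

definition input_size :: "int list \<Rightarrow> nat" where
  "input_size xs = (\<Sum>x\<leftarrow>xs. 1 + nat (bitlen \<bar>x\<bar>))"

text \<open>\<open>A\<close> solves the promise problem with instances \<open>I\<close>, encoding \<open>enc\<close> and question \<open>Q\<close>.
  The answer is returned in register 0.\<close>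

definition decides_in_poly_time ::
  "ram_com \<Rightarrow> 'i set \<Rightarrow> ('i \<Rightarrow> int list) \<Rightarrow> ('i \<Rightarrow> bool) \<Rightarrow> bool" where
  "decides_in_poly_time A I enc Q \<longleftrightarrow>
     (\<exists>P :: nat poly. \<forall>x\<in>I. \<exists>t s. ram_exec A (ram_input (enc x)) t s \<and>
        t \<le> poly P (input_size (enc x)) \<and> s 0 = (if Q x then 1 else 0))"

text \<open>A graph with vertex set \<open>{..<n}\<close> is presented to the machine by \<open>n\<close> and its adjacency matrix,
  row by row.\<close>

definition encode_instance :: "nat \<times> nat set set \<times> int \<times> int \<Rightarrow> int list" where
  "encode_instance = (\<lambda>(n, E, b, w).
     [int n, b, w] @ [if {i, j} \<in> E then 1 else 0. i \<leftarrow> [0..<n], j \<leftarrow> [0..<n]])"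

end

theory Submission
  imports Defs
begin

text \<open>Let \<open>H\<close> be the complement of the given permutation graph. Ordering the vertices along both lines of
  a diagram shows that \<open>H\<close> is the comparability graph of a partial order of dimension at most two. The
  diagram is not part of the input, but a transitive orientation \<open>D\<close> of \<open>H\<close> can be computed: orient
  each forcing class (generated by \<open>a \<rightarrow> b\<close> forces \<open>a \<rightarrow> c\<close> if \<open>b\<close>, \<open>c\<close> are not adjacent in \<open>H\<close>, and dually)
  so that its lexicographically first edge points upwards. By the triangle lemma this leaves no directed
  triangle.

  In a colouring every black vertex is \<open>D\<close>-comparable with every white one, so the coloured vertices split
  into a chain of monochromatic blocks, each entirely below the next. As \<open>D\<close> has dimension two, the set
  of common upper bounds of a block is that of two of its elements \<open>u\<close>, \<open>v\<close>; hence a cut of the chain is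
  given by a pair of vertices, and it suffices to compute which numbers of black and white vertices
  can be reached at each of the polynomially many pairs. Surplus vertices may be uncoloured afterwards.

  Forcing classes and reachable numbers are least fixed points of quaternary relations over \<open>{0..n}\<close>. They
  are computed by a small language of expressions and bounded loops, whose translation to the random access
  machine has a running time polynomial in \<open>n\<close> by construction.\<close>

section \<open>A language of bounded loops on the random access machine\<close>

text \<open>The value 100 leaves room for all temporaries of the two compiled programs, as
  \<open>need_tables\<close> and \<open>need_answer\<close> check.\<close>

definition reg_bound :: nat where "reg_bound = 100"

text \<open>\<open>Var k\<close> is the \<open>k\<close>-th variable in scope, counted from the outermost one; a binder appends its variable
  to the environment. All sums and loops run over \<open>{0..<M}\<close>, where \<open>M\<close> is the content of register 4.
  Addresses below \<^term>\<open>reg_bound\<close> are reserved for temporaries: reading them yields 0, writing to them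
  has no effect.\<close>

datatype expr =
    Num int
  | Var nat
  | Plus expr expr
  | Minus expr expr
  | Mem expr
  | Cond expr expr expr
  | SumM expr

fun den :: "nat \<Rightarrow> (nat \<Rightarrow> int) \<Rightarrow> int list \<Rightarrow> expr \<Rightarrow> int" where
  "den M m vs (Num c) = c"
| "den M m vs (Var k) = (if k < length vs then vs ! k else 0)"
| "den M m vs (Plus e1 e2) = den M m vs e1 + den M m vs e2"
| "den M m vs (Minus e1 e2) = den M m vs e1 - den M m vs e2"
| "den M m vs (Mem e) = (if int reg_bound \<le> den M m vs e then m (nat (den M m vs e)) else 0)"
| "den M m vs (Cond e1 e2 e3) = (if den M m vs e1 > 0 then den M m vs e2 else den M m vs e3)"
| "den M m vs (SumM e) = (\<Sum>v<M. den M m (vs @ [int v]) e)"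

text \<open>Counts the consecutive registers, starting at the target register, that the compiled
  code may overwrite. A sum takes three of its own: accumulator, bound variable and loop
  guard.\<close>

fun need :: "expr \<Rightarrow> nat" where
  "need (Num c) = 1"
| "need (Var k) = 1"
| "need (Plus e1 e2) = max (need e1) (1 + need e2)"
| "need (Minus e1 e2) = max (need e1) (1 + need e2)"
| "need (Mem e) = max (need e) 2"
| "need (Cond e1 e2 e3) = max (need e1) (max (need e2) (need e3))"
| "need (SumM e) = 3 + need e"

text \<open>The result goes to register \<open>r\<close>; \<open>env\<close> lists the registers of
  the variables. The machine tests only positivity, so an address is compared with
  \<open>reg_bound - 1\<close> by subtraction, and the loop of a sum is guarded by the number of
  remaining rounds in \<open>r + 2\<close>.\<close>

fun ecomp :: "nat list \<Rightarrow> nat \<Rightarrow> expr \<Rightarrow> ram_com" where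
  "ecomp env r (Num c) = Const r c"
| "ecomp env r (Var k) = (if k < length env then Seq (Const r 0) (Add r r (env ! k)) else Const r 0)"
| "ecomp env r (Plus e1 e2) = Seq (ecomp env r e1) (Seq (ecomp env (r + 1) e2) (Add r r (r + 1)))"
| "ecomp env r (Minus e1 e2) = Seq (ecomp env r e1) (Seq (ecomp env (r + 1) e2) (Sub r r (r + 1)))"
| "ecomp env r (Mem e) = Seq (ecomp env r e) (Seq (Const (r + 1) (int reg_bound - 1))
     (Seq (Sub (r + 1) r (r + 1)) (IfPos (r + 1) (Load r r) (Const r 0))))"
| "ecomp env r (Cond e1 e2 e3) = Seq (ecomp env r e1) (IfPos r (ecomp env r e2) (ecomp env r e3))"
| "ecomp env r (SumM e) = Seq (Const r 0) (Seq (Const (r + 1) 0) (Seq (Add (r + 2) 4 r)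
     (WhilePos (r + 2)
       (Seq (ecomp (env @ [r + 1]) (r + 3) e) (Seq (Add r r (r + 3)) (Seq (Const (r + 3) 1)
         (Seq (Add (r + 1) (r + 1) (r + 3)) (Sub (r + 2) 4 (r + 1)))))))))"

text \<open>The polynomial variable stands for \<open>M\<close>. Both branches of a conditional are
  charged, which makes the bound independent of memory and environment.\<close>

fun cost :: "expr \<Rightarrow> nat poly" where
  "cost (Num c) = [:1:]"
| "cost (Var k) = [:2:]"
| "cost (Plus e1 e2) = cost e1 + cost e2 + [:1:]"
| "cost (Minus e1 e2) = cost e1 + cost e2 + [:1:]"
| "cost (Mem e) = cost e + [:4:]"
| "cost (Cond e1 e2 e3) = cost e1 + cost e2 + cost e3 + [:1:]"
| "cost (SumM e) = [:4:] + [:0, 1:] * (cost e + [:5:])"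

text \<open>Keeping all variables and the loop bound in register 4 strictly below \<open>r\<close>
  protects them from code that works from \<open>r\<close> upwards.\<close>

definition env_ok :: "nat \<Rightarrow> nat list \<Rightarrow> nat \<Rightarrow> ram_state \<Rightarrow> int list \<Rightarrow> bool" where
  "env_ok M env r s vs \<longleftrightarrow> 4 < r \<and> s 4 = int M \<and> length vs = length env \<and>
     (\<forall>i < length env. env ! i < r \<and> s (env ! i) = vs ! i)"

definition same_mem :: "ram_state \<Rightarrow> (nat \<Rightarrow> int) \<Rightarrow> bool" where
  "same_mem s m \<longleftrightarrow> (\<forall>a\<ge>reg_bound. s a = m a)"

definition below :: "nat \<Rightarrow> ram_state \<Rightarrow> ram_state \<Rightarrow> bool" where
  "below r s s' \<longleftrightarrow> (\<forall>a<r. s' a = s a)"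

lemma env_ok_below:
  "env_ok M env r s vs \<Longrightarrow> below r s s' \<Longrightarrow> r \<le> r' \<Longrightarrow> env_ok M env r' s' vs"
  unfolding env_ok_def below_def by fastforce

lemma env_ok_snoc:
  "env_ok M env r s vs \<Longrightarrow> r \<le> k \<Longrightarrow> k < r' \<Longrightarrow> s k = v \<Longrightarrow> env_ok M (env @ [k]) r' s (vs @ [v])"
  unfolding env_ok_def by (fastforce simp: nth_append less_Suc_eq)

lemma below_trans: "below r s s' \<Longrightarrow> below r' s' s'' \<Longrightarrow> r \<le> r' \<Longrightarrow> below r s s''"
  unfolding below_def by force

lemma below_refl: "below r s s"
  unfolding below_def by simp

lemma below_upd: "below r s s' \<Longrightarrow> r \<le> k \<Longrightarrow> below r s (s'(k := x))"
  unfolding below_def by auto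

lemma same_mem_upd: "same_mem s m \<Longrightarrow> k < reg_bound \<Longrightarrow> same_mem (s(k := x)) m"
  unfolding same_mem_def by auto

lemma need_pos: "0 < need e"
  by (induction e) auto

lemma execI:
  "ram_exec c s t s' \<Longrightarrow> t \<le> T \<Longrightarrow> R s' \<Longrightarrow> \<exists>t s'. ram_exec c s t s' \<and> t \<le> T \<and> R s'"
  by blast

text \<open>Induction on the number of remaining rounds, which the guard register \<open>c\<close>
  holds; each round costs the body and one test.\<close>

lemma loop_correct:
  assumes body: "\<And>v s. v < M \<Longrightarrow> I v s \<Longrightarrow> s x = int v \<Longrightarrow>
      \<exists>t s'. ram_exec body s t s' \<and> t \<le> T \<and> I (Suc v) s' \<and> s' x = int v + 1 \<and> s' c = int M - s' x"
    and init: "I v s" "s x = int v" "s c = int M - s x" "v \<le> M"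
  shows "\<exists>t s'. ram_exec (WhilePos c body) s t s' \<and> t \<le> 1 + (M - v) * (T + 1) \<and> I M s'"
  using init
proof (induction "M - v" arbitrary: v s)
  case 0
  then have "v = M" by simp
  with 0 show ?case by (intro execI[where t = 1 and s' = s]) (use ram_exec.WhileFalse[of s c body] in auto)
next
  case (Suc k)
  then have lt: "v < M" by simp
  obtain t s' where b: "ram_exec body s t s'" "t \<le> T" "I (Suc v) s'" "s' x = int v + 1" "s' c = int M - s' x"
    using body[OF lt Suc.prems(1,2)] by blast
  have "\<exists>t s''. ram_exec (WhilePos c body) s' t s'' \<and> t \<le> 1 + (M - Suc v) * (T + 1) \<and> I M s''"
    using Suc.hyps(1)[of "Suc v" s'] Suc.hyps(2) b lt by auto
  then obtain t2 s'' where r: "ram_exec (WhilePos c body) s' t2 s''" "t2 \<le> 1 + (M - Suc v) * (T + 1)" "I M s''"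
    by blast
  have "s c > 0" using Suc.prems lt by simp
  from ram_exec.WhileTrue[OF this b(1) r(1)] have "ram_exec (WhilePos c body) s (1 + t + t2) s''" .
  moreover have "M - v = Suc (M - Suc v)" using lt by simp
  ultimately show ?case using b(2) r(2,3) by (intro exI[of _ "1 + t + t2"] exI[of _ s'']) (auto simp: algebra_simps)
qed

text \<open>The conclusion \<open>below r s s'\<close> carries the induction: a second operand
  evaluated from \<open>r + 1\<close> on leaves the first one in \<open>r\<close> and all variables
  untouched.\<close>

lemma ecomp_correct:
  assumes "env_ok M env r s vs" "same_mem s m" "r + need e \<le> reg_bound"
  shows "\<exists>t s'. ram_exec (ecomp env r e) s t s' \<and> t \<le> poly (cost e) M \<and>
    s' r = den M m vs e \<and> below r s s' \<and> same_mem s' m"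
  using assms
proof (induction e arbitrary: env r s vs)
  case (Num c)
  have "below r s (s(r := c))" "same_mem (s(r := c)) m"
    using below_upd[OF below_refl] same_mem_upd Num by auto
  with ram_exec.Const[of r c s] show ?case
    by (intro execI[where t = 1 and s' = "s(r := c)"]) (simp_all del: fun_upd_apply, simp)
next
  case (Var k)
  show ?case
  proof (cases "k < length env")
    case True
    have "ram_exec (Seq (Const r 0) (Add r r (env ! k))) s (1 + 1)
        ((s(r := 0))(r := (s(r := 0)) r + (s(r := 0)) (env ! k)))"
      by (rule ram_exec.Seq[OF ram_exec.Const ram_exec.Add])
    moreover have "below r s ((s(r := 0))(r := (s(r := 0)) r + (s(r := 0)) (env ! k)))"
      by (intro below_upd below_refl) auto
    moreover have "same_mem ((s(r := 0))(r := (s(r := 0)) r + (s(r := 0)) (env ! k))) m"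
      using Var by (intro same_mem_upd) auto
    moreover have "((s(r := 0))(r := (s(r := 0)) r + (s(r := 0)) (env ! k))) r = den M m vs (Var k)"
      using True Var by (auto simp: env_ok_def)
    moreover have "1 + 1 \<le> poly (cost (Var k)) M" by simp
    ultimately show ?thesis using True
      by (intro execI[where t = "1 + 1" and s' = "(s(r := 0))(r := (s(r := 0)) r + (s(r := 0)) (env ! k))"])
        (auto simp del: fun_upd_apply fun_upd_upd one_add_one den.simps cost.simps)
  next
    case False
    then have "den M m vs (Var k) = 0" using Var by (simp add: env_ok_def)
    then show ?thesis
      using False Var ram_exec.Const[of r 0 s] below_upd[OF below_refl, of r r s 0] same_mem_upd[of s m r 0]
      by (intro execI[where t = 1 and s' = "s(r := 0)"]) (simp_all del: fun_upd_apply, simp)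
  qed
next
  case (Plus e1 e2)
  have le: "r + (need e1) \<le> reg_bound" "r + (1 + need e2) \<le> reg_bound"
    using Plus.prems(3) unfolding need.simps by linarith+
  obtain t1 s1 where 1: "ram_exec (ecomp env r e1) s t1 s1" "t1 \<le> poly (cost e1) M"
      "s1 r = den M m vs e1" "below r s s1" "same_mem s1 m"
    using Plus.IH(1)[OF Plus.prems(1,2)] le by auto
  obtain t2 s2 where 2: "ram_exec (ecomp env (r + 1) e2) s1 t2 s2" "t2 \<le> poly (cost e2) M"
      "s2 (r + 1) = den M m vs e2" "below (r + 1) s1 s2" "same_mem s2 m"
    using Plus.IH(2)[OF env_ok_below[OF Plus.prems(1) 1(4), of "r + 1"] 1(5)] le by auto
  define s3 where "s3 = s2(r := s2 r + s2 (r + 1))"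
  have "ram_exec (ecomp env r (Plus e1 e2)) s (t1 + (t2 + 1)) s3"
    unfolding ecomp.simps s3_def by (rule ram_exec.Seq[OF 1(1) ram_exec.Seq[OF 2(1) ram_exec.Add]])
  moreover have "s2 r = s1 r" using 2(4) by (simp add: below_def)
  then have "s3 r = den M m vs (Plus e1 e2)" using 1(3) 2(3) by (simp add: s3_def)
  moreover have "below r s s3" using below_trans[OF 1(4) 2(4)] unfolding s3_def by (intro below_upd) auto
  moreover have "same_mem s3 m" using 2(5) le need_pos[of e1] unfolding s3_def by (intro same_mem_upd) auto
  ultimately show ?case using 1 2 by (intro execI[where t = "t1 + (t2 + 1)" and s' = s3]) auto
next
  case (Minus e1 e2)
  have le: "r + (need e1) \<le> reg_bound" "r + (1 + need e2) \<le> reg_bound"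
    using Minus.prems(3) unfolding need.simps by linarith+
  obtain t1 s1 where 1: "ram_exec (ecomp env r e1) s t1 s1" "t1 \<le> poly (cost e1) M"
      "s1 r = den M m vs e1" "below r s s1" "same_mem s1 m"
    using Minus.IH(1)[OF Minus.prems(1,2)] le by auto
  obtain t2 s2 where 2: "ram_exec (ecomp env (r + 1) e2) s1 t2 s2" "t2 \<le> poly (cost e2) M"
      "s2 (r + 1) = den M m vs e2" "below (r + 1) s1 s2" "same_mem s2 m"
    using Minus.IH(2)[OF env_ok_below[OF Minus.prems(1) 1(4), of "r + 1"] 1(5)] le by auto
  define s3 where "s3 = s2(r := s2 r - s2 (r + 1))"
  have "ram_exec (ecomp env r (Minus e1 e2)) s (t1 + (t2 + 1)) s3"
    unfolding ecomp.simps s3_def by (rule ram_exec.Seq[OF 1(1) ram_exec.Seq[OF 2(1) ram_exec.Sub]])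
  moreover have "s2 r = s1 r" using 2(4) by (simp add: below_def)
  then have "s3 r = den M m vs (Minus e1 e2)" using 1(3) 2(3) by (simp add: s3_def)
  moreover have "below r s s3" using below_trans[OF 1(4) 2(4)] unfolding s3_def by (intro below_upd) auto
  moreover have "same_mem s3 m" using 2(5) le need_pos[of e1] unfolding s3_def by (intro same_mem_upd) auto
  ultimately show ?case using 1 2 by (intro execI[where t = "t1 + (t2 + 1)" and s' = s3]) auto
next
  case (Mem e)
  have le: "r + (need e) \<le> reg_bound" "r + (2) \<le> reg_bound"
    using Mem.prems(3) unfolding need.simps by linarith+
  obtain t1 s1 where 1: "ram_exec (ecomp env r e) s t1 s1" "t1 \<le> poly (cost e) M"
      "s1 r = den M m vs e" "below r s s1" "same_mem s1 m"
    using Mem.IH[OF Mem.prems(1,2)] le by auto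
  let ?s2 = "s1(r + 1 := int reg_bound - 1)"
  let ?s3 = "?s2(r + 1 := ?s2 r - ?s2 (r + 1))"
  let ?v = "den M m vs (Mem e)"
  have sm: "same_mem ?s3 m" using 1(5) le by (intro same_mem_upd) auto
  have ex: "ram_exec (IfPos (r + 1) (Load r r) (Const r 0)) ?s3 (1 + 1) (?s3(r := ?v))"
  proof (cases "int reg_bound \<le> den M m vs e")
    case True
    have "ram_exec (IfPos (r + 1) (Load r r) (Const r 0)) ?s3 (1 + 1) (?s3(r := ?s3 (nat (?s3 r))))"
      by (intro ram_exec.IfTrue ram_exec.Load) (use True 1 in auto)
    moreover have "?s3 (nat (?s3 r)) = ?v"
    proof -
      have "?s3 r = den M m vs e" using 1(3) by simp
      then show ?thesis using sm True by (simp add: same_mem_def le_nat_iff del: fun_upd_apply)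
    qed
    ultimately show ?thesis by simp
  next
    case False
    have "ram_exec (IfPos (r + 1) (Load r r) (Const r 0)) ?s3 (1 + 1) (?s3(r := 0))"
      by (intro ram_exec.IfFalse ram_exec.Const) (use False 1 in auto)
    then show ?thesis using False by simp
  qed
  define s4 where "s4 = ?s3(r := ?v)"
  have "ram_exec (ecomp env r (Mem e)) s (t1 + (1 + (1 + (1 + 1)))) s4"
    unfolding ecomp.simps(5) s4_def
    by (rule ram_exec.Seq[OF 1(1)] ram_exec.Seq[OF ram_exec.Const] ram_exec.Seq[OF ram_exec.Sub] ex)+
  moreover have "below r s s4" using 1(4) unfolding s4_def by (intro below_upd) auto
  moreover have "same_mem s4 m" using 1(5) le unfolding s4_def by (intro same_mem_upd) auto
  moreover have "s4 r = ?v" by (simp add: s4_def)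
  ultimately show ?case using 1(2) by (intro execI[where t = "t1 + (1 + (1 + (1 + 1)))" and s' = s4]) auto
next
  case (Cond e1 e2 e3)
  have le: "r + (need e1) \<le> reg_bound" "r + (need e2) \<le> reg_bound" "r + (need e3) \<le> reg_bound"
    using Cond.prems(3) unfolding need.simps by linarith+
  obtain t1 s1 where 1: "ram_exec (ecomp env r e1) s t1 s1" "t1 \<le> poly (cost e1) M"
      "s1 r = den M m vs e1" "below r s s1" "same_mem s1 m"
    using Cond.IH(1)[OF Cond.prems(1,2)] le by auto
  note ok = env_ok_below[OF Cond.prems(1) 1(4) order_refl]
  show ?case
  proof (cases "den M m vs e1 > 0")
    case True
    obtain t2 s2 where 2: "ram_exec (ecomp env r e2) s1 t2 s2" "t2 \<le> poly (cost e2) M"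
      "s2 r = den M m vs e2" "below r s1 s2" "same_mem s2 m"
      using Cond.IH(2)[OF ok 1(5)] le by auto
    have "ram_exec (ecomp env r (Cond e1 e2 e3)) s (t1 + (1 + t2)) s2"
      unfolding ecomp.simps by (rule ram_exec.Seq[OF 1(1) ram_exec.IfTrue[OF _ 2(1)]]) (use True 1 in auto)
    then show ?thesis using 1 2 True below_trans[OF 1(4) 2(4)]
      by (intro execI[where t = "t1 + (1 + t2)" and s' = s2]) auto
  next
    case False
    obtain t2 s2 where 2: "ram_exec (ecomp env r e3) s1 t2 s2" "t2 \<le> poly (cost e3) M"
      "s2 r = den M m vs e3" "below r s1 s2" "same_mem s2 m"
      using Cond.IH(3)[OF ok 1(5)] le by auto
    have "ram_exec (ecomp env r (Cond e1 e2 e3)) s (t1 + (1 + t2)) s2"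
      unfolding ecomp.simps by (rule ram_exec.Seq[OF 1(1) ram_exec.IfFalse[OF _ 2(1)]]) (use False 1 in auto)
    then show ?thesis using 1 2 False below_trans[OF 1(4) 2(4)]
      by (intro execI[where t = "t1 + (1 + t2)" and s' = s2]) auto
  qed
next
  case (SumM e)
  define I where "I v s' \<longleftrightarrow> below r s s' \<and> same_mem s' m \<and> s' r = (\<Sum>v<v. den M m (vs @ [int v]) e)" for v s'
  define body where "body = Seq (ecomp (env @ [r + 1]) (r + 3) e) (Seq (Add r r (r + 3)) (Seq (Const (r + 3) 1)
         (Seq (Add (r + 1) (r + 1) (r + 3)) (Sub (r + 2) 4 (r + 1)))))"
  define T where "T = poly (cost e) M + 4"
  have lt: "r + 3 < reg_bound" using SumM.prems(3) need_pos[of e] by simp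
  have r4: "4 < r" using SumM.prems(1) by (simp add: env_ok_def)
  have body: "\<exists>t s''. ram_exec body s' t s'' \<and> t \<le> T \<and> I (Suc v) s'' \<and> s'' (r + 1) = int v + 1 \<and>
      s'' (r + 2) = int M - s'' (r + 1)"
    if I: "I v s'" and v: "s' (r + 1) = int v" for v s'
  proof -
    have ok: "env_ok M (env @ [r + 1]) (r + 3) s' (vs @ [int v])"
      using env_ok_snoc[OF env_ok_below[OF SumM.prems(1) _ order_refl, of s'], of "r + 1" "r + 3" "int v"] I v
      by (simp add: I_def)
    obtain t1 s1 where 1: "ram_exec (ecomp (env @ [r + 1]) (r + 3) e) s' t1 s1" "t1 \<le> poly (cost e) M"
      "s1 (r + 3) = den M m (vs @ [int v]) e" "below (r + 3) s' s1" "same_mem s1 m"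
      using SumM.IH[OF ok] I SumM.prems(3) by (auto simp: I_def)
    let ?s2 = "s1(r := s1 r + s1 (r + 3))"
    let ?s3 = "?s2(r + 3 := 1)"
    let ?s4 = "?s3(r + 1 := ?s3 (r + 1) + ?s3 (r + 3))"
    define s5 where "s5 = ?s4(r + 2 := ?s4 4 - ?s4 (r + 1))"
    have "ram_exec body s' (t1 + (1 + (1 + (1 + 1)))) s5"
      unfolding body_def s5_def by (rule ram_exec.Seq[OF 1(1)] ram_exec.Seq[OF ram_exec.Const]
          ram_exec.Seq[OF ram_exec.Add] ram_exec.Sub)+
    moreover have b: "below r s s1" using I below_trans[OF _ 1(4)] by (simp add: I_def)
    then have "below r s s5" unfolding s5_def by (intro below_upd) auto
    moreover have "same_mem s5 m" using lt 1(5) unfolding s5_def by (intro same_mem_upd) auto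
    moreover have "s1 4 = int M" using b SumM.prems(1) by (simp add: below_def env_ok_def)
    moreover have "s1 r = s' r" "s1 (r + 1) = s' (r + 1)" using 1(4) by (simp_all add: below_def)
    moreover have "s5 r = s1 r + s1 (r + 3)" "s5 (r + 1) = s1 (r + 1) + 1" "s5 (r + 2) = s1 4 - (s1 (r + 1) + 1)"
      using r4 by (auto simp: s5_def)
    ultimately show ?thesis using 1 I v r4
      by (intro execI[where t = "t1 + (1 + (1 + (1 + 1)))" and s' = s5]) (auto simp: I_def T_def)
  qed
  let ?s0 = "s(r := 0)"
  let ?s1 = "?s0(r + 1 := 0)"
  let ?s2 = "?s1(r + 2 := ?s1 4 + ?s1 r)"
  have M: "s 4 = int M" using SumM.prems(1) by (simp add: env_ok_def)
  have "I 0 ?s2" using SumM.prems lt by (auto simp: I_def intro!: below_upd below_refl same_mem_upd)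
  then obtain t s' where w: "ram_exec (WhilePos (r + 2) body) ?s2 t s'" "t \<le> 1 + (M - 0) * (T + 1)" "I M s'"
    using loop_correct[of M I "r + 1" body T "r + 2" 0 ?s2] body M r4 by auto
  have "ram_exec (ecomp env r (SumM e)) s (1 + (1 + (1 + t))) s'"
    unfolding ecomp.simps body_def[symmetric]
    by (rule ram_exec.Seq[OF ram_exec.Const] ram_exec.Seq[OF ram_exec.Add] w)+
  then show ?case using w(2,3)
    by (intro exI[of _ "1 + (1 + (1 + t))"] exI[of _ s']) (auto simp: I_def T_def algebra_simps)
qed

section \<open>Commands: memory writes and bounded loops\<close>

datatype cmd = Put expr expr | CSeq cmd cmd | For cmd

fun run :: "nat \<Rightarrow> int list \<Rightarrow> cmd \<Rightarrow> (nat \<Rightarrow> int) \<Rightarrow> (nat \<Rightarrow> int)" where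
  "run M vs (Put a e) m = (if int reg_bound \<le> den M m vs a then m(nat (den M m vs a) := den M m vs e) else m)"
| "run M vs (CSeq c1 c2) m = run M vs c2 (run M vs c1 m)"
| "run M vs (For c) m = fold (\<lambda>v. run M (vs @ [int v]) c) [0..<M] m"

fun cneed :: "cmd \<Rightarrow> nat" where
  "cneed (Put a e) = max (need a) (max (1 + need e) 3)"
| "cneed (CSeq c1 c2) = max (cneed c1) (cneed c2)"
| "cneed (For c) = 2 + cneed c"

fun ccomp :: "nat list \<Rightarrow> nat \<Rightarrow> cmd \<Rightarrow> ram_com" where
  "ccomp env r (Put a e) = Seq (ecomp env r a) (Seq (ecomp env (r + 1) e) (Seq (Const (r + 2) (int reg_bound - 1))
     (Seq (Sub (r + 2) r (r + 2)) (IfPos (r + 2) (Store r (r + 1)) Skip))))"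
| "ccomp env r (CSeq c1 c2) = Seq (ccomp env r c1) (ccomp env r c2)"
| "ccomp env r (For c) = Seq (Const r 0) (Seq (Add (r + 1) 4 r)
     (WhilePos (r + 1)
       (Seq (ccomp (env @ [r]) (r + 2) c) (Seq (Const (r + 2) 1)
         (Seq (Add r r (r + 2)) (Sub (r + 1) 4 r))))))"

fun ccost :: "cmd \<Rightarrow> nat poly" where
  "ccost (Put a e) = cost a + cost e + [:4:]"
| "ccost (CSeq c1 c2) = ccost c1 + ccost c2"
| "ccost (For c) = [:3:] + [:0, 1:] * (ccost c + [:4:])"

lemma cneed_pos: "0 < cneed c"
  by (induction c) auto

text \<open>The memory \<open>m\<close> is generalised in the induction because commands change it.
  Writes cannot disturb the temporaries, since every effective target address is at least
  \<open>reg_bound\<close>.\<close>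

lemma ccomp_correct:
  assumes "env_ok M env r s vs" "same_mem s m" "r + cneed c \<le> reg_bound"
  shows "\<exists>t s'. ram_exec (ccomp env r c) s t s' \<and> t \<le> poly (ccost c) M \<and>
    below r s s' \<and> same_mem s' (run M vs c m)"
  using assms
proof (induction c arbitrary: env r s vs m)
  case (Put a e)
  have le: "r + need a \<le> reg_bound" "r + 1 + need e \<le> reg_bound" "r + 2 < reg_bound"
    using Put.prems(3) unfolding cneed.simps by linarith+
  obtain t1 s1 where 1: "ram_exec (ecomp env r a) s t1 s1" "t1 \<le> poly (cost a) M"
      "s1 r = den M m vs a" "below r s s1" "same_mem s1 m"
    using ecomp_correct[OF Put.prems(1,2), of a] le by auto
  obtain t2 s2 where 2: "ram_exec (ecomp env (r + 1) e) s1 t2 s2" "t2 \<le> poly (cost e) M"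
      "s2 (r + 1) = den M m vs e" "below (r + 1) s1 s2" "same_mem s2 m"
    using ecomp_correct[OF env_ok_below[OF Put.prems(1) 1(4), of "r + 1"] 1(5), of e] le by auto
  have s2r: "s2 r = den M m vs a" using 2(4) 1(3) by (simp add: below_def)
  have b: "below r s s2" using below_trans[OF 1(4) 2(4)] by simp
  let ?s3 = "s2(r + 2 := int reg_bound - 1)"
  let ?s4 = "?s3(r + 2 := ?s3 r - ?s3 (r + 2))"
  have sm: "same_mem ?s4 m" using 2(5) le by (intro same_mem_upd) auto
  have b4: "below r s ?s4" using b by (intro below_upd) auto
  define s5 where "s5 = (if int reg_bound \<le> den M m vs a then ?s4(nat (den M m vs a) := den M m vs e) else ?s4)"
  have ex: "ram_exec (IfPos (r + 2) (Store r (r + 1)) Skip) ?s4 (1 + 1) s5"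
  proof (cases "int reg_bound \<le> den M m vs a")
    case True
    have "ram_exec (IfPos (r + 2) (Store r (r + 1)) Skip) ?s4 (1 + 1) (?s4(nat (?s4 r) := ?s4 (r + 1)))"
      by (intro ram_exec.IfTrue ram_exec.Store) (use True s2r in auto)
    then show ?thesis using True s2r 2(3) by (simp add: s5_def)
  next
    case False
    have "ram_exec (IfPos (r + 2) (Store r (r + 1)) Skip) ?s4 (1 + 1) ?s4"
      by (intro ram_exec.IfFalse ram_exec.Skip) (use False s2r in auto)
    then show ?thesis using False by (simp add: s5_def)
  qed
  have "ram_exec (ccomp env r (Put a e)) s (t1 + (t2 + (1 + (1 + (1 + 1))))) s5"
    unfolding ccomp.simps by (rule ram_exec.Seq[OF 1(1)] ram_exec.Seq[OF 2(1)]
        ram_exec.Seq[OF ram_exec.Const] ram_exec.Seq[OF ram_exec.Sub] ex)+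
  moreover have "below r s s5"
    using b4 le by (auto simp: s5_def le_nat_iff intro!: below_upd)
  moreover have "same_mem s5 (run M vs (Put a e) m)"
    using sm unfolding same_mem_def s5_def run.simps by (auto simp del: den.simps)
  ultimately show ?case using 1(2) 2(2)
    by (intro execI[where t = "t1 + (t2 + (1 + (1 + (1 + 1))))" and s' = s5]) auto
next
  case (CSeq c1 c2)
  have le: "r + (cneed c1) \<le> reg_bound" "r + (cneed c2) \<le> reg_bound"
    using CSeq.prems(3) unfolding cneed.simps by linarith+
  obtain t1 s1 where 1: "ram_exec (ccomp env r c1) s t1 s1" "t1 \<le> poly (ccost c1) M"
      "below r s s1" "same_mem s1 (run M vs c1 m)"
    using CSeq.IH(1)[OF CSeq.prems(1,2)] le by auto
  obtain t2 s2 where 2: "ram_exec (ccomp env r c2) s1 t2 s2" "t2 \<le> poly (ccost c2) M"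
      "below r s1 s2" "same_mem s2 (run M vs c2 (run M vs c1 m))"
    using CSeq.IH(2)[OF env_ok_below[OF CSeq.prems(1) 1(3) order_refl] 1(4)] le by auto
  show ?case using 1 2 below_trans[OF 1(3) 2(3)]
    by (intro execI[where t = "t1 + t2" and s' = s2]) (auto intro: ram_exec.Seq)
next
  case (For c)
  define I where "I v s' \<longleftrightarrow> below r s s' \<and> same_mem s' (fold (\<lambda>v. run M (vs @ [int v]) c) [0..<v] m)" for v s'
  define body where "body = Seq (ccomp (env @ [r]) (r + 2) c) (Seq (Const (r + 2) 1)
         (Seq (Add r r (r + 2)) (Sub (r + 1) 4 r)))"
  define T where "T = poly (ccost c) M + 3"
  have lt: "r + 2 < reg_bound" using For.prems(3) cneed_pos[of c] by simp
  have r4: "4 < r" using For.prems(1) by (simp add: env_ok_def)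
  have body: "\<exists>t s''. ram_exec body s' t s'' \<and> t \<le> T \<and> I (Suc v) s'' \<and> s'' r = int v + 1 \<and>
      s'' (r + 1) = int M - s'' r"
    if I: "I v s'" and v: "s' r = int v" for v s'
  proof -
    have ok: "env_ok M (env @ [r]) (r + 2) s' (vs @ [int v])"
      using env_ok_snoc[OF env_ok_below[OF For.prems(1) _ order_refl, of s'], of r "r + 2" "int v"] I v
      by (simp add: I_def)
    obtain t1 s1 where 1: "ram_exec (ccomp (env @ [r]) (r + 2) c) s' t1 s1" "t1 \<le> poly (ccost c) M"
      "below (r + 2) s' s1" "same_mem s1 (fold (\<lambda>v. run M (vs @ [int v]) c) [0..<Suc v] m)"
      using For.IH[OF ok, of "fold (\<lambda>v. run M (vs @ [int v]) c) [0..<v] m"] I For.prems(3) by (auto simp: I_def)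
    let ?s3 = "s1(r + 2 := 1)"
    let ?s4 = "?s3(r := ?s3 r + ?s3 (r + 2))"
    define s5 where "s5 = ?s4(r + 1 := ?s4 4 - ?s4 r)"
    have "ram_exec body s' (t1 + (1 + (1 + 1))) s5"
      unfolding body_def s5_def by (rule ram_exec.Seq[OF 1(1)] ram_exec.Seq[OF ram_exec.Const]
          ram_exec.Seq[OF ram_exec.Add] ram_exec.Sub)+
    moreover have b: "below r s s1" using I below_trans[OF _ 1(3)] by (simp add: I_def)
    then have "below r s s5" unfolding s5_def by (intro below_upd) auto
    moreover have "same_mem s5 (fold (\<lambda>v. run M (vs @ [int v]) c) [0..<Suc v] m)"
      using lt 1(4) unfolding s5_def by (intro same_mem_upd) auto
    moreover have "s1 4 = int M" using b For.prems(1) by (simp add: below_def env_ok_def)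
    moreover have "s1 r = s' r" using 1(3) by (simp_all add: below_def)
    moreover have "s5 r = s1 r + 1" "s5 (r + 1) = s1 4 - (s1 r + 1)"
      using r4 by (auto simp: s5_def)
    ultimately show ?thesis using 1 I v r4
      by (intro execI[where t = "t1 + (1 + (1 + 1))" and s' = s5]) (auto simp: I_def T_def)
  qed
  let ?s0 = "s(r := 0)"
  let ?s2 = "?s0(r + 1 := ?s0 4 + ?s0 r)"
  have M: "s 4 = int M" using For.prems(1) by (simp add: env_ok_def)
  have "I 0 ?s2" using For.prems lt by (auto simp: I_def intro!: below_upd below_refl same_mem_upd)
  then obtain t s' where w: "ram_exec (WhilePos (r + 1) body) ?s2 t s'" "t \<le> 1 + (M - 0) * (T + 1)" "I M s'"
    using loop_correct[of M I r body T "r + 1" 0 ?s2] body M r4 by auto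
  have "ram_exec (ccomp env r (For c)) s (1 + (1 + t)) s'"
    unfolding ccomp.simps body_def[symmetric]
    by (rule ram_exec.Seq[OF ram_exec.Const] ram_exec.Seq[OF ram_exec.Add] w)+
  then show ?case using w(2,3)
    by (intro exI[of _ "1 + (1 + t)"] exI[of _ s']) (auto simp: I_def T_def algebra_simps)
qed

section \<open>Transitive orientation and cuts\<close>

locale two_orders =
  fixes n :: int and P Q :: "int \<Rightarrow> real"
  assumes n0: "0 \<le> n" and injP: "inj_on P {0..<n}" and injQ: "inj_on Q {0..<n}"
begin

abbreviation V where "V \<equiv> {0..<n}"

text \<open>The transitive orientation of the complement that the diagram provides. It occurs in the
  correctness proof only; the algorithm has to find an orientation of its own.\<close>

definition T where "T x y \<longleftrightarrow> x \<in> V \<and> y \<in> V \<and> P x < P y \<and> Q x < Q y"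

text \<open>The crossing pairs, oriented by the upper line: a transitive orientation of the
  permutation graph itself, whose complement is \<open>H\<close>.\<close>

definition opp where "opp x y \<longleftrightarrow> x \<in> V \<and> y \<in> V \<and> P x < P y \<and> Q y < Q x"

definition H where "H x y \<longleftrightarrow> T x y \<or> T y x"

lemma T_trans: "T x y \<Longrightarrow> T y z \<Longrightarrow> T x z"
  and T_irrefl: "\<not> T x x"
  unfolding T_def by auto

lemma opp_trans: "opp x y \<Longrightarrow> opp y z \<Longrightarrow> opp x z"
  unfolding opp_def by auto

lemma H_sym: "H x y \<Longrightarrow> H y x"
  and H_irrefl: "\<not> H x x"
  and H_V: "H x y \<Longrightarrow> x \<in> V \<and> y \<in> V"
  unfolding H_def T_def by auto

lemma opp_H: "opp x y \<Longrightarrow> \<not> H x y \<and> \<not> H y x"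
  unfolding H_def T_def opp_def by auto

lemma trichotomy: "x \<in> V \<Longrightarrow> y \<in> V \<Longrightarrow> x \<noteq> y \<Longrightarrow> H x y \<or> opp x y \<or> opp y x"
  using inj_onD[OF injP, of x y] inj_onD[OF injQ, of x y]
  unfolding H_def T_def opp_def by (meson linorder_neqE_linordered_idom)

text \<open>\<open>G p q a b\<close>: orienting \<open>p\<close> towards \<open>q\<close> forces \<open>a\<close> towards \<open>b\<close> in a transitive orientation of \<open>H\<close>.\<close>

inductive G :: "int \<Rightarrow> int \<Rightarrow> int \<Rightarrow> int \<Rightarrow> bool" where
  G_refl: "H p q \<Longrightarrow> G p q p q"
| G_head: "G p q a c \<Longrightarrow> H a b \<Longrightarrow> \<not> H c b \<Longrightarrow> G p q a b"
| G_tail: "G p q c b \<Longrightarrow> H a b \<Longrightarrow> \<not> H c a \<Longrightarrow> G p q a b"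

lemma G_H: "G p q a b \<Longrightarrow> H p q \<and> H a b"
  by (induction rule: G.induct) auto

lemma G_trans: "G a b c d \<Longrightarrow> G p q a b \<Longrightarrow> G p q c d"
  by (induction rule: G.induct) (auto intro: G.intros)

text \<open>Every single forcing step can be undone, because its non-adjacency condition is
  symmetric.\<close>

lemma G_sym: "G p q a b \<Longrightarrow> G a b p q"
proof (induction rule: G.induct)
  case (G_head p q a c b)
  then have "G a b a c" using G_H H_sym by (meson G.intros)
  then show ?case using G_head G_trans by blast
next
  case (G_tail p q c b a)
  then have "G a b c b" using G_H H_sym by (meson G.intros)
  then show ?case using G_tail G_trans by blast
qed (auto intro: G.intros)

lemma G_rev: "G p q a b \<Longrightarrow> G q p b a"
  by (induction rule: G.induct) (auto intro: G.intros H_sym)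

text \<open>If a forced edge were oriented against \<open>T\<close>, transitivity of
  \<open>T\<close> would make the two outer vertices of the forcing step adjacent.\<close>

lemma G_T: "G p q a b \<Longrightarrow> T p q \<Longrightarrow> T a b"
  by (induction rule: G.induct) (auto simp: H_def intro: T_trans)

text \<open>Here it matters that \<open>H\<close> is a comparability graph: by \<open>G_T\<close> a
  forcing class lies entirely inside \<open>T\<close> or entirely inside its converse.\<close>

lemma G_not_rev: "\<not> G p q q p"
proof
  assume "G p q q p"
  then have "T p q \<or> T q p" "T p q \<Longrightarrow> T q p" "T q p \<Longrightarrow> T p q"
    using G_T G_rev G_H H_def by blast+
  then show False using T_trans T_irrefl by blast
qed

section \<open>The canonical orientation and its transitivity\<close>

definition lex :: "int \<Rightarrow> int \<Rightarrow> int \<Rightarrow> int \<Rightarrow> bool" where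
  "lex c d p q \<longleftrightarrow> c < p \<or> (c = p \<and> d < q)"

text \<open>Competing pairs are taken from the forcing class and from its reversal, so that of two
  opposite classes exactly one contains a leader.\<close>

definition leader where
  "leader p q \<longleftrightarrow> p < q \<and> (\<forall>c d. c < d \<and> lex c d p q \<longrightarrow> \<not> G p q c d \<and> \<not> G p q d c)"

text \<open>The orientation of \<open>H\<close> in which the lexicographically first pair of every forcing class points upwards.\<close>

definition D where "D a b \<longleftrightarrow> (\<exists>p q. leader p q \<and> G p q a b)"

lemma D_H: "D a b \<Longrightarrow> H a b"
  unfolding D_def using G_H by blast

lemma D_G: "D a b \<Longrightarrow> G a b c d \<Longrightarrow> D c d"
  unfolding D_def using G_trans by blast

text \<open>Both leaders would be the lexicographic minimum of the same class together with its
  reversal. They would coincide and force their own reversal.\<close>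

lemma D_antisym: "D a b \<Longrightarrow> \<not> D b a"
proof
  assume "D a b" "D b a"
  then obtain p q p' q' where l: "leader p q" "G p q a b" "leader p' q'" "G p' q' b a"
    unfolding D_def by blast
  then have "G p q q' p'" by (meson G_rev G_sym G_trans)
  moreover from this have "G p' q' q p" by (meson G_rev G_sym)
  ultimately have "\<not> lex p' q' p q" "\<not> lex p q p' q'"
    using l unfolding leader_def by blast+
  then have "p = p'" "q = q'" unfolding lex_def by auto
  then show False using \<open>G p q q' p'\<close> G_not_rev by blast
qed

text \<open>\<open>A\<close> collects the upward pairs of the class of \<open>(a, b)\<close> and of
  its reversal. Minimising the first component and then the second gives the lexicographic minimum
  of \<open>A\<close>, which is a leader.\<close>

lemma D_total:
  assumes "H a b" shows "D a b \<or> D b a"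
proof -
  define A where "A = {(p, q). p < q \<and> (G a b p q \<or> G a b q p)}"
  have sub: "A \<subseteq> V \<times> V" unfolding A_def using G_H H_V by blast
  have fin: "finite A" using finite_subset[OF sub] by simp
  have "(min a b, max a b) \<in> A" using assms H_irrefl G_refl unfolding A_def by (auto simp: min_def max_def) (metis order_le_less)
  then have ne: "A \<noteq> {}" by blast
  define p where "p = Min (fst ` A)"
  have p: "p \<in> fst ` A" unfolding p_def using fin ne by (intro Min_in) auto
  define B where "B = {q. (p, q) \<in> A}"
  have "B \<subseteq> V" using sub unfolding B_def by auto
  then have finB: "finite B" using finite_subset by blast
  have neB: "B \<noteq> {}" using p unfolding B_def by auto
  define q where "q = Min B"
  have "q \<in> B" unfolding q_def using finB neB by (intro Min_in) auto
  then have pq: "(p, q) \<in> A" unfolding B_def by simp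
  have least: "\<not> lex c d p q" if "(c, d) \<in> A" for c d
  proof -
    have "p \<le> c" unfolding p_def using that fin by (intro Min_le) (auto intro: rev_image_eqI)
    moreover have "q \<le> d" if "c = p"
      unfolding q_def using \<open>(c, d) \<in> A\<close> that finB by (intro Min_le) (auto simp: B_def)
    ultimately show ?thesis unfolding lex_def by auto
  qed
  have "leader p q"
    unfolding leader_def
  proof (intro conjI allI impI)
    show "p < q" using pq unfolding A_def by blast
    fix c d assume cd: "c < d \<and> lex c d p q"
    have eq: "G a b p q \<or> G b a p q" using pq G_rev unfolding A_def by blast
    show "\<not> G p q c d"
    proof
      assume "G p q c d"
      then have "G a b c d \<or> G b a c d" using eq G_trans by blast
      then have "(c, d) \<in> A" using cd G_rev unfolding A_def by blast
      then show False using least cd by blast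
    qed
    show "\<not> G p q d c"
    proof
      assume "G p q d c"
      then have "G a b d c \<or> G b a d c" using eq G_trans by blast
      then have "(c, d) \<in> A" using cd G_rev unfolding A_def by blast
      then show False using least cd by blast
    qed
  qed
  then show ?thesis using pq G_sym G_rev unfolding A_def D_def by blast
qed

text \<open>Golumbic's triangle lemma: forcing one side of a directed triangle drags along the other two.\<close>

lemma triangle:
  assumes "G b c b' c'" "D a b" "D b c" "D c a"
  shows "G a b a b' \<and> G c a c' a"
  using assms
proof (induction rule: G.induct)
  case (G_refl p q)
  then show ?case using D_H G.G_refl by blast
next
  case (G_head p q b c c'')
  then have IH: "G a p a b" "G q a c a" by auto
  have D: "D b c''" using D_G G.G_head[OF G_head.hyps(1)] G_head by blast
  \<comment> \<open>Otherwise \<open>b -> c''\<close> would force \<open>b -> a\<close>, against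
    \<open>D a b\<close>. With this adjacency, the non-adjacency of \<open>c\<close> and
    \<open>c''\<close> turns \<open>c -> a\<close> into \<open>c'' -> a\<close>.\<close>
  have "H a c''"
  proof (rule ccontr)
    assume "\<not> H a c''"
    moreover have "H b a" using IH(1) G_H H_sym by blast
    ultimately have "G b c'' b a" using D D_H H_sym by (meson G.intros)
    then have "D b a" using D D_G by blast
    moreover have "D a b" using IH(1) G_head.prems D_G by blast
    ultimately show False using D_antisym by blast
  qed
  then have "G q a c'' a" using IH(2) G_head.hyps H_sym by (meson G.intros)
  then show ?case using IH by blast
next
  case (G_tail p q b c b'')
  then have IH: "G a p a b" "G q a c a" by auto
  have D: "D b'' c" using D_G G.G_tail[OF G_tail.hyps(1)] G_tail by blast
  have "H a b''"
  proof (rule ccontr)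
    assume "\<not> H a b''"
    moreover have "H a c" using IH(2) G_H H_sym by blast
    ultimately have "G b'' c a c" using D D_H H_sym by (meson G.intros)
    then have "D a c" using D D_G by blast
    moreover have "D c a" using IH(2) G_tail.prems D_G by blast
    ultimately show False using D_antisym by blast
  qed
  then have "G a p a b''" using IH(1) G_tail.hyps by (meson G.intros)
  then show ?case using IH by blast
qed

text \<open>The triangle lemma moves the side \<open>b\<close>, \<open>c\<close> onto its leader
  \<open>p'\<close>, \<open>q'\<close>, and then the side \<open>a\<close>, \<open>p'\<close> onto
  \<open>p\<close>, \<open>q\<close>; this yields an edge from \<open>q'\<close> to
  \<open>p\<close>. As the pair \<open>a\<close>, \<open>p'\<close> lies in the class of the leader
  \<open>p\<close>, \<open>q\<close>, minimality gives \<open>p <= p'\<close>, and the comparison of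
  the two leaders leaves only \<open>p = p'\<close>. Then \<open>p'\<close> and \<open>q'\<close>
  are joined in both directions.\<close>

lemma no_cycle_aux:
  assumes D: "D a b" "D b c" "D c a"
    and l: "leader p q" "G p q a b" "leader p' q'" "G p' q' b c" "\<not> lex p q p' q'"
  shows False
proof -
  have "G b c p' q'" using l G_sym by blast
  then have t: "G a b a p'" "G c a q' a" using triangle[OF _ D] by blast+
  have D': "D a p'" "D q' a" "D p' q'" using D_G t D l(4) G_sym by blast+
  have "G a p' p q" using t(1) l(2) G_sym G_trans by blast
  then have "G q' a q' p" using triangle[OF _ D'(2) D'(1) D'(3)] by blast
  then have "D q' p" using D' D_G by blast
  have "G p q a p'" using \<open>G a p' p q\<close> G_sym by blast
  moreover have "a \<noteq> p'" using D'(1) D_H H_irrefl by blast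
  ultimately have "\<not> lex (min a p') (max a p') p q"
    using l(1) unfolding leader_def by (auto simp: min_def max_def)
  then have "p \<le> p'" unfolding lex_def by auto
  then have "p = p'" using l(5) unfolding lex_def by auto
  then show False using \<open>D q' p\<close> D'(3) D_antisym by blast
qed

text \<open>The three leaders cannot increase strictly all the way round, so the preceding lemma
  applies to some rotation of the triangle.\<close>

lemma no_cycle: "D a b \<Longrightarrow> D b c \<Longrightarrow> \<not> D c a"
proof
  assume D: "D a b" "D b c" "D c a"
  obtain p q where 1: "leader p q" "G p q a b" using D(1) D_def by blast
  obtain p' q' where 2: "leader p' q'" "G p' q' b c" using D(2) D_def by blast
  obtain p'' q'' where 3: "leader p'' q''" "G p'' q'' c a" using D(3) D_def by blast
  have "\<not> lex p q p' q' \<or> \<not> lex p' q' p'' q'' \<or> \<not> lex p'' q'' p q"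
    unfolding lex_def by auto
  then show False
    using no_cycle_aux[OF D 1 2] no_cycle_aux[OF D(2,3,1) 2 3] no_cycle_aux[OF D(3,1,2) 3 1] by blast
qed

text \<open>If \<open>a\<close> and \<open>c\<close> were not adjacent, \<open>a -> b\<close> would
  force \<open>c -> b\<close>. The wrong direction between \<open>a\<close> and \<open>c\<close>
  would close a directed triangle.\<close>

lemma D_trans:
  assumes "D a b" "D b c" shows "D a c"
proof -
  have "H a c"
  proof (rule ccontr)
    assume "\<not> H a c"
    then have "G a b c b" using assms D_H H_sym by (meson G.intros)
    then show False using assms D_G D_antisym by blast
  qed
  then show ?thesis using D_total no_cycle assms by blast
qed

section \<open>Dimension two of the orientation\<close>

lemma D_irrefl: "\<not> D x x"
  using D_antisym by blast

lemma D_V: "D x y \<Longrightarrow> x \<in> V \<and> y \<in> V"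
  using D_H H_V by blast

text \<open>\<open>X'\<close> is a transitive orientation of the complement of \<open>H\<close>,
  used for \<open>opp\<close> and its converse. In a mixed case, an edge from \<open>z\<close> to
  \<open>x\<close> would compose with the given edge of its own kind and so put the pair of the
  other given edge both into \<open>H\<close> and into its complement.\<close>

lemma ext_trans:
  assumes XT: "\<And>x y z. X' x y \<Longrightarrow> X' y z \<Longrightarrow> X' x z"
    and XH: "\<And>x y. X' x y \<Longrightarrow> \<not> H x y \<and> \<not> H y x"
    and tri: "\<And>x y. x \<in> V \<Longrightarrow> y \<in> V \<Longrightarrow> x \<noteq> y \<Longrightarrow> H x y \<or> X' x y \<or> X' y x"
    and XV: "\<And>x y. X' x y \<Longrightarrow> x \<in> V \<and> y \<in> V"
    and 1: "D x y \<or> X' x y" and 2: "D y z \<or> X' y z"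
  shows "D x z \<or> X' x z"
proof -
  have V: "x \<in> V" "z \<in> V" using 1 2 XV D_V by blast+
  consider "D x y" "D y z" | "X' x y" "X' y z" | "D x y" "X' y z" | "X' x y" "D y z" using 1 2 by blast
  then show ?thesis
  proof cases
    case 3
    have "x \<noteq> z" using 3 XH D_H by blast
    moreover have "\<not> D z x" using 3 XH D_H D_trans by blast
    moreover have "\<not> X' z x" using 3 XT XH D_H by blast
    ultimately show ?thesis using tri[OF V] D_total by blast
  next
    case 4
    have "x \<noteq> z" using 4 XH D_H by blast
    moreover have "\<not> D z x" using 4 XH D_H D_trans by blast
    moreover have "\<not> X' z x" using 4 XT XH D_H by blast
    ultimately show ?thesis using tri[OF V] D_total by blast
  qed (use XT D_trans in blast)+
qed

lemma finite_has_top: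
  assumes "finite A" "A \<noteq> {}"
    and tr: "\<And>x y z. R x y \<Longrightarrow> R y z \<Longrightarrow> R x z"
    and "\<And>x y. x \<in> A \<Longrightarrow> y \<in> A \<Longrightarrow> x \<noteq> y \<Longrightarrow> R x y \<or> R y x"
  shows "\<exists>u\<in>A. \<forall>x\<in>A. x = u \<or> R x u"
  using assms(1,2,4)
proof (induction rule: finite_ne_induct)
  case (insert x F)
  then obtain u where u: "u \<in> F" "\<forall>x\<in>F. x = u \<or> R x u" by auto
  show ?case
  proof (cases "R u x")
    case True
    have "R y x" if "y \<in> F" for y
      using that u(2) True tr[of y u x] by auto
    then show ?thesis by auto
  next
    case False
    have "x \<noteq> u" using u(1) insert.hyps by auto
    then have "R x u" using insert.prems[of x u] u(1) False by simp
    then show ?thesis using u by auto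
  qed
qed auto

text \<open>\<open>D\<close> and the incomparable pairs, oriented in either of two ways, form two linear orders whose
  intersection is \<open>D\<close>; \<open>u\<close> and \<open>v\<close> are the top elements of \<open>A\<close> in them.\<close>

lemma two_tops:
  assumes "A \<subseteq> V" "A \<noteq> {}"
  shows "\<exists>u\<in>A. \<exists>v\<in>A. \<forall>z. D u z \<and> D v z \<longrightarrow> (\<forall>x\<in>A. D x z)"
proof -
  have fin: "finite A" using assms finite_subset by blast
  have XV: "\<And>x y. opp x y \<Longrightarrow> x \<in> V \<and> y \<in> V" unfolding opp_def by blast
  define R1 where "R1 x y \<longleftrightarrow> D x y \<or> opp x y" for x y
  define R2 where "R2 x y \<longleftrightarrow> D x y \<or> opp y x" for x y
  have tr1: "R1 x y \<Longrightarrow> R1 y z \<Longrightarrow> R1 x z" for x y z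
    using ext_trans[of opp x y z] opp_trans opp_H trichotomy XV unfolding R1_def by blast
  have tr2: "R2 x y \<Longrightarrow> R2 y z \<Longrightarrow> R2 x z" for x y z
    using ext_trans[of "\<lambda>x y. opp y x" x y z] opp_trans opp_H trichotomy XV unfolding R2_def by blast
  have tot1: "x \<in> A \<Longrightarrow> y \<in> A \<Longrightarrow> x \<noteq> y \<Longrightarrow> R1 x y \<or> R1 y x" for x y
    using trichotomy[of x y] D_total assms(1) unfolding R1_def by blast
  have tot2: "x \<in> A \<Longrightarrow> y \<in> A \<Longrightarrow> x \<noteq> y \<Longrightarrow> R2 x y \<or> R2 y x" for x y
    using trichotomy[of x y] D_total assms(1) unfolding R2_def by blast
  have top1: "\<exists>u\<in>A. \<forall>x\<in>A. x = u \<or> R1 x u"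
    by (rule finite_has_top[OF fin assms(2)]) (use tr1 tot1 in blast)+
  have top2: "\<exists>u\<in>A. \<forall>x\<in>A. x = u \<or> R2 x u"
    by (rule finite_has_top[OF fin assms(2)]) (use tr2 tot2 in blast)+
  obtain u where u: "u \<in> A" "\<forall>x\<in>A. x = u \<or> R1 x u"
    using top1 by blast
  obtain v where v: "v \<in> A" "\<forall>x\<in>A. x = v \<or> R2 x v"
    using top2 by blast
  have "D x z" if z: "D u z" "D v z" and x: "x \<in> A" for x z
  proof -
    have "R1 u z" "R2 v z" using z unfolding R1_def R2_def by blast+
    then have "R1 x z" "R2 x z" using u(2) v(2) x tr1[of x u z] tr2[of x v z] by auto
    then show ?thesis unfolding R1_def R2_def opp_def by auto
  qed
  then show ?thesis using u v by blast
qed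

text \<open>\<open>n\<close> serves as an additional bottom element.\<close>

definition D' where "D' x y \<longleftrightarrow> D x y \<or> (x = n \<and> y \<in> V)"

text \<open>The largest block that fits between two cuts. Taking all of it loses nothing, because
  surplus vertices may be uncoloured later.\<close>

definition block where
  "block u v u' v' = {z. D' u z \<and> D' v z \<and> (\<forall>y. D' u' y \<and> D' v' y \<longrightarrow> D' z y)}"

text \<open>\<open>S u v i j\<close>: there is a colouring with \<open>i\<close> black and \<open>j\<close> white vertices all of which lie below every
  common upper bound of \<open>u\<close> and \<open>v\<close>. The pair \<open>u\<close>, \<open>v\<close> plays the role of a scanline of the diagram.\<close>

inductive S :: "int \<Rightarrow> int \<Rightarrow> int \<Rightarrow> int \<Rightarrow> bool" where
  S_init: "S n n 0 0"
| S_black: "S u v i j \<Longrightarrow> D' u u' \<Longrightarrow> D' u v' \<Longrightarrow> D' v u' \<Longrightarrow> D' v v' \<Longrightarrow>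
    S u' v' (i + int (card (block u v u' v'))) j"
| S_white: "S u v i j \<Longrightarrow> D' u u' \<Longrightarrow> D' u v' \<Longrightarrow> D' v u' \<Longrightarrow> D' v v' \<Longrightarrow>
    S u' v' i (j + int (card (block u v u' v')))"

lemma D'_V: "D' x y \<Longrightarrow> y \<in> V"
  unfolding D'_def using D_V by blast

lemma D'_trans: "D' x y \<Longrightarrow> D' y z \<Longrightarrow> D' x z"
  unfolding D'_def using D_trans D_V by fastforce

lemma D'_D: "x \<in> V \<Longrightarrow> D' x y \<longleftrightarrow> D x y"
  unfolding D'_def by auto

lemma D'_irrefl: "\<not> D' x x"
  using D_irrefl D'_def by auto

section \<open>Colourings as chains of cuts\<close>

definition bw where
  "bw B W \<longleftrightarrow> B \<subseteq> V \<and> W \<subseteq> V \<and> B \<inter> W = {} \<and> (\<forall>x\<in>B. \<forall>y\<in>W. H x y)"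

lemma bw_sym: "bw B W \<Longrightarrow> bw W B"
  unfolding bw_def using H_sym by blast

text \<open>Elements of the block are common upper bounds of \<open>u\<close> and \<open>v\<close>,
  so all vertices coloured before lie below them; this gives disjointness and adjacency in
  \<open>H\<close>. The old vertices also lie below \<open>u'\<close>, hence below everything above
  the new cut. The white case follows by exchanging the colours.\<close>

lemma bw_extend:
  fixes u v u' v' :: int
  assumes "bw B W" "\<And>x y. x \<in> B \<union> W \<Longrightarrow> D' u y \<Longrightarrow> D' v y \<Longrightarrow> D' x y"
    "D' u u'" "D' v u'"
  defines "C \<equiv> block u v u' v'"
  shows "bw (B \<union> C) W" "int (card (B \<union> C)) = int (card B) + int (card C)"
    "\<And>x y. x \<in> (B \<union> C) \<union> W \<Longrightarrow> D' u' y \<Longrightarrow> D' v' y \<Longrightarrow> D' x y"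
proof -
  have C: "C \<subseteq> V" unfolding C_def block_def using D'_V by blast
  have lt: "D' x z" if "x \<in> B \<union> W" "z \<in> C" for x z
    using assms(2) that unfolding C_def block_def by blast
  have V: "B \<subseteq> V" "W \<subseteq> V" using assms(1) unfolding bw_def by auto
  have fin: "finite B" "finite C" using V C finite_subset by blast+
  have disj: "(B \<union> W) \<inter> C = {}" using lt D'_irrefl by blast
  then show "int (card (B \<union> C)) = int (card B) + int (card C)"
    using fin card_Un_disjoint[of B C] by (simp add: Int_Un_distrib2)
  have "H y x" if "x \<in> W" "y \<in> C" for x y
    using lt[of x y] that V D'_D D_H H_sym by blast
  then show "bw (B \<union> C) W" using assms(1) C disj unfolding bw_def by blast
  show "D' x y" if x: "x \<in> (B \<union> C) \<union> W" and y: "D' u' y" "D' v' y" for x y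
  proof (cases "x \<in> C")
    case True
    then show ?thesis using y unfolding C_def block_def by blast
  next
    case False
    then show ?thesis using assms(2)[of x y] x y D'_trans assms(3,4) by blast
  qed
qed

lemma S_sound:
  assumes "S u v i j"
  shows "\<exists>B W. bw B W \<and> int (card B) = i \<and> int (card W) = j \<and>
    (\<forall>x\<in>B \<union> W. \<forall>y. D' u y \<and> D' v y \<longrightarrow> D' x y)"
  using assms
proof (induction rule: S.induct)
  case S_init
  show ?case by (intro exI[of _ "{}"]) (auto simp: bw_def)
next
  case (S_black u v i j u' v')
  then obtain B W where BW: "bw B W" "int (card B) = i" "int (card W) = j"
    "\<forall>x\<in>B \<union> W. \<forall>y. D' u y \<and> D' v y \<longrightarrow> D' x y" by blast
  have ub: "\<And>x y. x \<in> B \<union> W \<Longrightarrow> D' u y \<Longrightarrow> D' v y \<Longrightarrow> D' x y" using BW(4) by blast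
  note ext = bw_extend[OF BW(1) ub S_black.hyps(2,4), where v' = v']
  have "bw (B \<union> block u v u' v') W" "int (card (B \<union> block u v u' v')) = i + int (card (block u v u' v'))"
    "\<forall>x\<in>(B \<union> block u v u' v') \<union> W. \<forall>y. D' u' y \<and> D' v' y \<longrightarrow> D' x y"
    using ext BW(2,3) by auto
  then show ?case using BW by blast
next
  case (S_white u v i j u' v')
  then obtain B W where BW: "bw W B" "int (card B) = i" "int (card W) = j"
    "\<forall>x\<in>W \<union> B. \<forall>y. D' u y \<and> D' v y \<longrightarrow> D' x y" using bw_sym by blast
  have ub: "\<And>x y. x \<in> W \<union> B \<Longrightarrow> D' u y \<Longrightarrow> D' v y \<Longrightarrow> D' x y" using BW(4) by blast
  note ext = bw_extend[OF BW(1) ub S_white.hyps(2,4), where v' = v']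
  have "bw (W \<union> block u v u' v') B" "int (card (W \<union> block u v u' v')) = j + int (card (block u v u' v'))"
    "\<forall>x\<in>(W \<union> block u v u' v') \<union> B. \<forall>y. D' u' y \<and> D' v' y \<longrightarrow> D' x y"
    using ext BW(2,3) by auto
  then show ?case using BW bw_sym by (metis Un_commute)
qed

text \<open>Ensures that a table over \<open>{0..n}\<close> has room for all of \<open>S\<close>:
  the counts are sizes of sets of vertices by \<open>S_sound\<close>.\<close>

lemma S_range:
  assumes "S u v i j"
  shows "u \<in> {0..n}" "v \<in> {0..n}" "i \<in> {0..n}" "j \<in> {0..n}"
proof -
  show "u \<in> {0..n}" "v \<in> {0..n}"
    using assms n0 D'_V by (cases rule: S.cases; force)+
  obtain B W where BW: "bw B W" "int (card B) = i" "int (card W) = j" using S_sound[OF assms] by blast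
  then have "card B \<le> card V" "card W \<le> card V" unfolding bw_def by (meson card_mono finite_atLeastLessThan_int)+
  then show "i \<in> {0..n}" "j \<in> {0..n}" using BW n0 by auto
qed

text \<open>The vertices of the colour of a maximal vertex \<open>x\<close> with no vertex of the other colour above them form
  the topmost monochromatic block.\<close>

lemma top_block:
  assumes "bw B W" "x \<in> B" "\<And>y. y \<in> B \<union> W \<Longrightarrow> \<not> D x y"
  defines "C \<equiv> {z \<in> B. \<forall>w\<in>W. \<not> D z w}"
  shows "x \<in> C" "\<And>y z. y \<in> (B - C) \<union> W \<Longrightarrow> z \<in> C \<Longrightarrow> D y z"
proof -
  show "x \<in> C" using assms unfolding C_def by blast
  fix y z assume y: "y \<in> (B - C) \<union> W" and z: "z \<in> C"
  have W: "D w z" if "w \<in> W" for w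
    using that z assms(1) D_total unfolding C_def bw_def by blast
  show "D y z"
  proof (cases "y \<in> W")
    case False
    \<comment> \<open>A black vertex outside \<open>C\<close> has a white vertex above it, and every
      white vertex is below \<open>z\<close>.\<close>
    then obtain w where "w \<in> W" "D y w" using y C_def by blast
    then show ?thesis using W D_trans by blast
  qed (use W in blast)
qed

lemma ex_maximal:
  assumes "finite A" "A \<noteq> {}" shows "\<exists>x\<in>A. \<forall>y\<in>A. \<not> D x y"
  using assms
proof (induction rule: finite_ne_induct)
  case (insert x F)
  then obtain u where u: "u \<in> F" "\<forall>y\<in>F. \<not> D u y" by blast
  show ?case
  proof (cases "D u x")
    case True
    then have "\<forall>y\<in>insert x F. \<not> D x y" using u D_trans D_irrefl by blast
    then show ?thesis by blast
  qed (use u in blast)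
qed (use D_irrefl in auto)

text \<open>\<open>A\<close> is the part already treated and \<open>C\<close> the next block. The
  new cut consists of the two elements of \<open>C\<close> supplied by \<open>two_tops\<close>;
  \<open>C\<close> fits into the block between the cuts because it lies above \<open>u\<close> and
  \<open>v\<close> and below all common upper bounds of \<open>u'\<close> and
  \<open>v'\<close>.\<close>

lemma S_extend:
  assumes A: "A \<subseteq> V" "C \<subseteq> V" "C \<noteq> {}" and lt: "\<And>y z. y \<in> A \<Longrightarrow> z \<in> C \<Longrightarrow> D y z"
    and S: "u \<in> insert n A" "v \<in> insert n A" "\<And>x z. D' u z \<Longrightarrow> D' v z \<Longrightarrow> x \<in> A \<Longrightarrow> D' x z"
  obtains u' v' where "u' \<in> C" "v' \<in> C"
    "D' u u'" "D' u v'" "D' v u'" "D' v v'" "card C \<le> card (block u v u' v')"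
    "\<And>x z. D' u' z \<Longrightarrow> D' v' z \<Longrightarrow> x \<in> A \<union> C \<Longrightarrow> D' x z"
proof -
  obtain u' v' where uv: "u' \<in> C" "v' \<in> C" "\<And>z x. D u' z \<Longrightarrow> D v' z \<Longrightarrow> x \<in> C \<Longrightarrow> D x z"
    using two_tops[OF A(2,3)] by blast
  have lt': "D' y z" if "y \<in> insert n A" "z \<in> C" for y z
    using that lt[of y z] A(2) unfolding D'_def by blast
  note up = lt'[OF S(1)] lt'[OF S(2)]
  have ub: "D' x z" if "D' u' z" "D' v' z" "x \<in> C" for x z
    using uv(3)[of z x] that uv(1,2) A(2) D'_D by (simp add: subset_iff)
  have "C \<subseteq> block u v u' v'" unfolding block_def using up ub by blast
  moreover have "block u v u' v' \<subseteq> V" unfolding block_def using D'_V by blast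
  then have "finite (block u v u' v')" using finite_subset by blast
  ultimately have card: "card C \<le> card (block u v u' v')" using card_mono by blast
  have "D' x z" if "D' u' z" "D' v' z" "x \<in> A \<union> C" for x z
  proof (cases "x \<in> C")
    case False
    then have "D' x u'" using that(3) lt' uv(1) by blast
    then show ?thesis using that(1) D'_trans by blast
  qed (use ub that in blast)
  from that[OF uv(1,2) up(1)[OF uv(1)] up(1)[OF uv(2)] up(2)[OF uv(1)] up(2)[OF uv(2)] card this]
  show thesis .
qed

text \<open>Induction by removing the topmost monochromatic block. Requiring \<open>u\<close> and
  \<open>v\<close> to be coloured vertices or the bottom \<open>n\<close> guarantees that they lie
  below the removed block when it is put back.\<close>

lemma S_complete:
  assumes "bw B W"
  shows "\<exists>u v i j. S u v i j \<and> int (card B) \<le> i \<and> int (card W) \<le> j \<and>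
    u \<in> insert n (B \<union> W) \<and> v \<in> insert n (B \<union> W) \<and>
    (\<forall>x\<in>B \<union> W. \<forall>z. D' u z \<and> D' v z \<longrightarrow> D' x z)"
  using assms
proof (induction "card (B \<union> W)" arbitrary: B W rule: less_induct)
  case less
  have V: "B \<subseteq> V" "W \<subseteq> V" using less.prems unfolding bw_def by auto
  have fin: "finite B" "finite W" using V finite_subset by blast+
  show ?case
  proof (cases "B \<union> W = {}")
    case True
    then show ?thesis using S_init by (intro exI) auto
  next
    case False
    then obtain x where x: "x \<in> B \<union> W" "\<forall>y\<in>B \<union> W. \<not> D x y" using ex_maximal fin by blast
    show ?thesis
    proof (cases "x \<in> B")
      case True
      define C where "C = {z \<in> B. \<forall>w\<in>W. \<not> D z w}"
      have C: "x \<in> C" "\<And>y z. y \<in> (B - C) \<union> W \<Longrightarrow> z \<in> C \<Longrightarrow> D y z"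
        using top_block[OF less.prems True] x unfolding C_def by blast+
      have CB: "C \<subseteq> B" unfolding C_def by blast
      have bw: "bw (B - C) W" using less.prems unfolding bw_def by blast
      have "x \<notin> W" using True less.prems unfolding bw_def by blast
      then have "(B - C) \<union> W \<subset> B \<union> W" using C(1) True by blast
      then have "card ((B - C) \<union> W) < card (B \<union> W)" using fin by (intro psubset_card_mono) auto
      from less.hyps[OF this bw] obtain u v i j where S: "S u v i j" "int (card (B - C)) \<le> i" "int (card W) \<le> j"
        "u \<in> insert n (B - C \<union> W)" "v \<in> insert n (B - C \<union> W)"
        "\<forall>x\<in>B - C \<union> W. \<forall>z. D' u z \<and> D' v z \<longrightarrow> D' x z" by blast
      have AV: "B - C \<union> W \<subseteq> V" "C \<subseteq> V" "C \<noteq> {}" using V CB C(1) by blast+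
      obtain u' v' where uv: "u' \<in> C" "v' \<in> C"
        "D' u u'" "D' u v'" "D' v u'" "D' v v'" "card C \<le> card (block u v u' v')"
        "\<And>x z. D' u' z \<Longrightarrow> D' v' z \<Longrightarrow> x \<in> (B - C \<union> W) \<union> C \<Longrightarrow> D' x z"
        by (rule S_extend[OF AV C(2) S(4,5)]) (use S(6) in blast)+
      have "card B = card (B - C) + card C"
        using CB fin card_mono[OF fin(1) CB] by (simp add: card_Diff_subset finite_subset)
      then have "int (card B) \<le> i + int (card (block u v u' v'))" using S(2) uv(7) by simp
      moreover have "S u' v' (i + int (card (block u v u' v'))) j" using S_black S(1) uv by blast
      moreover have "B \<union> W = (B - C \<union> W) \<union> C" using CB by blast
      ultimately show ?thesis using S(3) uv(1,2,8)
        by - (rule exI[of _ u'], rule exI[of _ v'], rule exI, rule exI[of _ j], auto)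
    next
      case False
      then have True: "x \<in> W" using x by blast
      define C where "C = {z \<in> W. \<forall>w\<in>B. \<not> D z w}"
      have C: "x \<in> C" "\<And>y z. y \<in> (W - C) \<union> B \<Longrightarrow> z \<in> C \<Longrightarrow> D y z"
        using top_block[OF bw_sym[OF less.prems] True] x unfolding C_def by blast+
      have CB: "C \<subseteq> W" unfolding C_def by blast
      have bw: "bw B (W - C)" using less.prems unfolding bw_def by blast
      have "B \<union> (W - C) \<subset> B \<union> W" using C(1) False True by blast
      then have "card (B \<union> (W - C)) < card (B \<union> W)" using fin by (intro psubset_card_mono) auto
      from less.hyps[OF this bw] obtain u v i j where S: "S u v i j" "int (card B) \<le> i" "int (card (W - C)) \<le> j"
        "u \<in> insert n (W - C \<union> B)" "v \<in> insert n (W - C \<union> B)"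
        "\<forall>x\<in>W - C \<union> B. \<forall>z. D' u z \<and> D' v z \<longrightarrow> D' x z" by blast
      have AV: "W - C \<union> B \<subseteq> V" "C \<subseteq> V" "C \<noteq> {}" using V CB C(1) by blast+
      obtain u' v' where uv: "u' \<in> C" "v' \<in> C"
        "D' u u'" "D' u v'" "D' v u'" "D' v v'" "card C \<le> card (block u v u' v')"
        "\<And>x z. D' u' z \<Longrightarrow> D' v' z \<Longrightarrow> x \<in> (W - C \<union> B) \<union> C \<Longrightarrow> D' x z"
        by (rule S_extend[OF AV C(2) S(4,5)]) (use S(6) in blast)+
      have "card W = card (W - C) + card C"
        using CB fin card_mono[OF fin(2) CB] by (simp add: card_Diff_subset finite_subset)
      then have "int (card W) \<le> j + int (card (block u v u' v'))" using S(3) uv(7) by simp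
      moreover have "S u' v' i (j + int (card (block u v u' v')))" using S_white S(1) uv by blast
      moreover have "B \<union> W = (W - C \<union> B) \<union> C" using CB by blast
      ultimately show ?thesis using S(2) uv(1,2,8)
        by - (rule exI[of _ u'], rule exI[of _ v'], rule exI[of _ i], rule exI, auto)
    qed
  qed
qed

text \<open>The inequalities account for uncolouring surplus vertices, the sign conditions for
  negative \<open>b\<close> or \<open>w\<close>, which no colouring realises.\<close>

lemma S_iff:
  "(\<exists>u v i j. S u v i j \<and> b \<le> i \<and> w \<le> j) \<and> 0 \<le> b \<and> 0 \<le> w \<longleftrightarrow>
   (\<exists>B W. bw B W \<and> int (card B) = b \<and> int (card W) = w)"
proof
  assume "(\<exists>u v i j. S u v i j \<and> b \<le> i \<and> w \<le> j) \<and> 0 \<le> b \<and> 0 \<le> w"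
  then obtain u v i j where S: "S u v i j" "b \<le> i" "w \<le> j" "0 \<le> b" "0 \<le> w" by blast
  obtain B W where BW: "bw B W" "int (card B) = i" "int (card W) = j" using S_sound[OF S(1)] by blast
  have le: "nat b \<le> card B" "nat w \<le> card W" using S BW by auto
  obtain B' where "B' \<subseteq> B" "card B' = nat b" by (rule obtain_subset_with_card_n[OF le(1)])
  moreover obtain W' where "W' \<subseteq> W" "card W' = nat w" by (rule obtain_subset_with_card_n[OF le(2)])
  moreover have "bw B' W'" using calculation BW(1) unfolding bw_def by blast
  ultimately have "bw B' W'" "int (card B') = b" "int (card W') = w" using S by auto
  then show "\<exists>B W. bw B W \<and> int (card B) = b \<and> int (card W) = w" by blast
next
  assume "\<exists>B W. bw B W \<and> int (card B) = b \<and> int (card W) = w"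
  then obtain B W where BW: "bw B W" "int (card B) = b" "int (card W) = w" by blast
  have "\<exists>u v i j. S u v i j \<and> int (card B) \<le> i \<and> int (card W) \<le> j"
    by (rule ex_forward[OF S_complete[OF BW(1)]], (erule ex_forward)+) simp
  then have "\<exists>u v i j. S u v i j \<and> b \<le> i \<and> w \<le> j" unfolding BW .
  then show "(\<exists>u v i j. S u v i j \<and> b \<le> i \<and> w \<le> j) \<and> 0 \<le> b \<and> 0 \<le> w" using BW by auto
qed

end

section \<open>Least fixed points of quaternary relations\<close>

text \<open>Models an update in place: membership is tested against the current set and not against
  the set at the beginning of the round.\<close>

definition step :: "('a set \<Rightarrow> 'a set) \<Rightarrow> 'a \<Rightarrow> 'a set \<Rightarrow> 'a set" where
  "step F p R = (if p \<in> F R then insert p R else R)"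

lemma fold_step_ge: "R \<subseteq> fold (step F) ps R"
  by (induction ps arbitrary: R) (auto simp: step_def, blast)

text \<open>By monotonicity, an element justified at the beginning of a round is still justified
  when its turn comes.\<close>

lemma fold_step_adds:
  assumes "mono F" shows "set ps \<inter> F R \<subseteq> fold (step F) ps R"
proof (induction ps arbitrary: R)
  case (Cons p ps)
  have "R \<subseteq> step F p R" by (auto simp: step_def)
  then have "F R \<subseteq> F (step F p R)" using assms by (simp add: monoD)
  then have "set ps \<inter> F R \<subseteq> fold (step F) (p # ps) R" using Cons.IH[of "step F p R"] by auto
  moreover have "p \<in> fold (step F) (p # ps) R" if "p \<in> F R"
    using that fold_step_ge[of "step F p R" F ps] by (auto simp: step_def)
  ultimately show ?case by auto
qed simp

lemma fold_step_le:
  assumes "mono F" "set ps \<inter> F L \<subseteq> L" "R \<subseteq> L"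
  shows "fold (step F) ps R \<subseteq> L"
  using assms(2,3)
proof (induction ps arbitrary: R)
  case (Cons p ps)
  have "F R \<subseteq> F L" using assms(1) Cons.prems(2) by (simp add: monoD)
  then have "step F p R \<subseteq> L" using Cons.prems by (auto simp: step_def)
  then show ?case using Cons.IH[of "step F p R"] Cons.prems(1) by auto
qed simp

text \<open>Each round over \<open>ps\<close> that does not end in a closed set adds an element of \<open>ps\<close>.\<close>

lemma iterate_closed:
  assumes "mono F" "card (set ps) \<le> N"
  defines "R \<equiv> (fold (step F) ps ^^ N) {}"
  shows "set ps \<inter> F R \<subseteq> R" "set ps \<inter> F L \<subseteq> L \<Longrightarrow> R \<subseteq> L"
proof -
  let ?f = "fold (step F) ps"
  have sub: "(?f ^^ k) {} \<subseteq> set ps" for k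
    by (induction k) (simp_all add: fold_step_le[OF assms(1)])
  have fin: "finite ((?f ^^ k) {})" for k
    using finite_subset[OF sub] by simp
  have grow: "set ps \<inter> F ((?f ^^ k) {}) \<subseteq> (?f ^^ k) {} \<or> k \<le> card ((?f ^^ k) {})" for k
  proof (induction k)
    case (Suc k)
    let ?R = "(?f ^^ k) {}"
    have S: "(?f ^^ Suc k) {} = ?f ?R" by simp
    show ?case
    proof (cases "set ps \<inter> F ?R \<subseteq> ?R")
      case True
      then have "?f ?R = ?R" using fold_step_le[OF assms(1), of ps ?R ?R] fold_step_ge[of ?R F ps] by blast
      then show ?thesis using True by simp
    next
      case False
      then have "?R \<subset> ?f ?R" using fold_step_adds[OF assms(1), of ps ?R] fold_step_ge[of ?R F ps] by blast
      then have "card ?R < card (?f ?R)" using fin[of "Suc k"] psubset_card_mono[of "?f ?R" ?R] by simp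
      then show ?thesis using Suc False by auto
    qed
  qed simp
  show "set ps \<inter> F R \<subseteq> R"
  proof (rule ccontr)
    assume not: "\<not> set ps \<inter> F R \<subseteq> R"
    then have "card (set ps) \<le> card R" using grow[of N] assms(2) unfolding R_def by auto
    then have "R = set ps" using sub[of N] unfolding R_def by (intro card_seteq) auto
    then show False using not by blast
  qed
  assume L: "set ps \<inter> F L \<subseteq> L"
  have "(?f ^^ k) {} \<subseteq> L" for k
    by (induction k) (simp_all add: fold_step_le[OF assms(1) L])
  then show "R \<subseteq> L" unfolding R_def .
qed

section \<open>Relations stored in memory\<close>

type_synonym quad = "int \<times> int \<times> int \<times> int"

definition quads :: "nat \<Rightarrow> quad list" where
  "quads M = concat (map (\<lambda>a. concat (map (\<lambda>b. concat (map (\<lambda>c. map (\<lambda>d. (int a, int b, int c, int d))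
     [0..<M]) [0..<M])) [0..<M])) [0..<M])"

abbreviation quad_list :: "quad \<Rightarrow> int list" where
  "quad_list \<equiv> \<lambda>(a, b, c, d). [a, b, c, d]"

abbreviation For4 :: "cmd \<Rightarrow> cmd" where
  "For4 c \<equiv> For (For (For (For c)))"

lemma fold_concat_map: "fold f (concat (map g xs)) = fold (\<lambda>x. fold f (g x)) xs"
  by (induction xs) auto

lemma run_For: "run M vs (For c) = fold (\<lambda>v. run M (vs @ [int v]) c) [0..<M]"
  by auto

lemma run_For4: "run M vs (For4 c) m = fold (\<lambda>p. run M (vs @ quad_list p) c) (quads M) m"
  by (simp add: run_For quads_def fold_concat_map fold_map comp_def del: run.simps)

lemma set_quads: "set (quads M) = {(a, b, c, d). {a, b, c, d} \<subseteq> {0..<int M}}"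
proof -
  have *: "{0..<int M} = int ` {0..<M}" by (simp add: image_int_atLeastLessThan)
  show ?thesis unfolding * by (auto simp: quads_def)
qed

definition EAnd :: "expr \<Rightarrow> expr \<Rightarrow> expr" where "EAnd e1 e2 = Cond e1 e2 (Num 0)"
definition EOr :: "expr \<Rightarrow> expr \<Rightarrow> expr" where "EOr e1 e2 = Cond e1 (Num 1) e2"
definition ENot :: "expr \<Rightarrow> expr" where "ENot e = Cond e (Num 0) (Num 1)"
definition ELess :: "expr \<Rightarrow> expr \<Rightarrow> expr" where "ELess e1 e2 = Minus e2 e1"
definition EEq :: "expr \<Rightarrow> expr \<Rightarrow> expr" where "EEq e1 e2 = EAnd (ENot (ELess e1 e2)) (ENot (ELess e2 e1))"
text \<open>Truth means positivity, so true values may be large and false ones negative. Reducing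
  them to 1 and 0 before summation prevents cancellation.\<close>

definition EEx :: "expr \<Rightarrow> expr" where "EEx e = SumM (Cond e (Num 1) (Num 0))"

definition sat :: "nat \<Rightarrow> (nat \<Rightarrow> int) \<Rightarrow> int list \<Rightarrow> expr \<Rightarrow> bool" where
  "sat M m vs e \<longleftrightarrow> 0 < den M m vs e"

lemma sat_EAnd: "sat M m vs (EAnd e1 e2) \<longleftrightarrow> sat M m vs e1 \<and> sat M m vs e2"
  and sat_EOr: "sat M m vs (EOr e1 e2) \<longleftrightarrow> sat M m vs e1 \<or> sat M m vs e2"
  and sat_ENot: "sat M m vs (ENot e) \<longleftrightarrow> \<not> sat M m vs e"
  and sat_ELess: "sat M m vs (ELess e1 e2) \<longleftrightarrow> den M m vs e1 < den M m vs e2"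
  and sat_EEq: "sat M m vs (EEq e1 e2) \<longleftrightarrow> den M m vs e1 = den M m vs e2"
  by (auto simp: sat_def EAnd_def EOr_def ENot_def ELess_def EEq_def)

text \<open>Serves both the existential quantifier and the computation of block sizes.\<close>

lemma den_count:
  "den M m vs (SumM (Cond e (Num 1) (Num 0))) = int (card {v \<in> {0..<int M}. sat M m (vs @ [v]) e})"
proof -
  have "den M m vs (SumM (Cond e (Num 1) (Num 0))) = (\<Sum>v<M. if sat M m (vs @ [int v]) e then 1 else 0)"
    by (simp add: sat_def cong: if_cong)
  also have "\<dots> = int (card {v \<in> {..<M}. sat M m (vs @ [int v]) e})"
    by (simp add: sum.If_cases Int_def)
  also have "card {v \<in> {..<M}. sat M m (vs @ [int v]) e} =
      card (int ` {v \<in> {..<M}. sat M m (vs @ [int v]) e})"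
    by (simp add: card_image)
  also have "int ` {v \<in> {..<M}. sat M m (vs @ [int v]) e} = {v \<in> {0..<int M}. sat M m (vs @ [v]) e}"
    by (auto simp: image_iff) (metis nonneg_int_cases of_nat_less_iff)
  finally show ?thesis .
qed

lemma sat_EEx: "sat M m vs (EEx e) \<longleftrightarrow> (\<exists>v\<in>{0..<int M}. sat M m (vs @ [v]) e)"
proof -
  have "finite {v \<in> {0..<int M}. sat M m (vs @ [v]) e}"
    by (rule finite_subset[of _ "{0..<int M}"]) auto
  then show ?thesis unfolding sat_def[of M m vs] EEx_def den_count of_nat_0_less_iff card_gt_0_iff by auto
qed

lemmas sat_simps = sat_EAnd sat_EOr sat_ENot sat_ELess sat_EEq sat_EEx

text \<open>Without multiplication on the machine, the Horner scheme in base \<open>M\<close> is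
  obtained by summing, \<open>M\<close> times, an expression that ignores the summation variable.
  \<open>Var 3\<close> holds the offset \<open>X\<close>; binders append at the end, so the indices
  remain valid inside the sums.\<close>

definition addr :: "nat \<Rightarrow> nat \<Rightarrow> nat \<Rightarrow> nat \<Rightarrow> nat \<Rightarrow> expr" where
  "addr t a b c d = Plus (Plus (Var 3) (Num (int reg_bound)))
     (Plus (SumM (Plus (SumM (Plus (SumM (Plus (SumM (Num (int t))) (Var a))) (Var b))) (Var c))) (Var d))"

definition tab :: "nat \<Rightarrow> nat \<Rightarrow> nat \<Rightarrow> nat \<Rightarrow> nat \<Rightarrow> expr" where
  "tab t a b c d = Mem (addr t a b c d)"

fun slot :: "int \<Rightarrow> nat \<Rightarrow> nat \<Rightarrow> quad \<Rightarrow> int" where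
  "slot X M t (a, b, c, d) = X + int reg_bound +
     ((((int t * int M + a) * int M + b) * int M + c) * int M + d)"

definition rel :: "int \<Rightarrow> nat \<Rightarrow> (nat \<Rightarrow> int) \<Rightarrow> nat \<Rightarrow> quad \<Rightarrow> bool" where
  "rel X M m t p \<longleftrightarrow> int reg_bound \<le> slot X M t p \<and> 0 < m (nat (slot X M t p))"

lemma den_addr:
  assumes "3 < length vs" "a < length vs" "b < length vs" "c < length vs" "d < length vs"
  shows "den M m vs (addr t a b c d) = slot (vs ! 3) M t (vs ! a, vs ! b, vs ! c, vs ! d)"
  using assms by (simp add: addr_def nth_append algebra_simps)

lemma sat_tab:
  assumes "3 < length vs" "a < length vs" "b < length vs" "c < length vs" "d < length vs"
  shows "sat M m vs (tab t a b c d) \<longleftrightarrow> rel (vs ! 3) M m t (vs ! a, vs ! b, vs ! c, vs ! d)"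
  unfolding sat_def tab_def den.simps den_addr[OF assms] rel_def by simp

lemma digit_unique:
  fixes a b x y k :: int
  assumes "x * k + a = y * k + b" "0 \<le> a" "a < k" "0 \<le> b" "b < k"
  shows "x = y \<and> a = b"
proof -
  have "(x * k + a) div k = x" "(y * k + b) div k = y" using assms(2-5) by auto
  then have "x = y" using assms(1) by metis
  then show ?thesis using assms(1) by simp
qed

text \<open>The base-\<open>M\<close> digits are stripped one by one from the right. The table
  number \<open>t\<close> is the leading part and may exceed \<open>M\<close>.\<close>

lemma slot_inj:
  assumes "slot X M t p = slot X M t' p'" "p \<in> set (quads M)" "p' \<in> set (quads M)"
  shows "t = t' \<and> p = p'"
proof -
  obtain a b c d where p: "p = (a, b, c, d)" by (cases p) auto
  obtain a' b' c' d' where p': "p' = (a', b', c', d')" by (cases p') auto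
  have r: "{a, b, c, d} \<subseteq> {0..<int M}" "{a', b', c', d'} \<subseteq> {0..<int M}"
    using assms(2,3) unfolding p p' set_quads by auto
  have 1: "((int t * int M + a) * int M + b) * int M + c = ((int t' * int M + a') * int M + b') * int M + c' \<and> d = d'"
    by (rule digit_unique[where k = "int M"]) (use assms(1) r in \<open>auto simp: p p'\<close>)
  then have 2: "(int t * int M + a) * int M + b = (int t' * int M + a') * int M + b' \<and> c = c'"
    by (intro digit_unique[where k = "int M"]) (use r in auto)
  then have 3: "int t * int M + a = int t' * int M + a' \<and> b = b'"
    by (intro digit_unique[where k = "int M"]) (use r in auto)
  then have "int t = int t' \<and> a = a'"
    by (intro digit_unique[where k = "int M"]) (use r in auto)
  then show ?thesis using 1 2 3 by (simp add: p p')
qed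

lemma slot_ge:
  assumes "p \<in> set (quads M)" shows "X + int reg_bound \<le> slot X M t p"
  using assms by (auto simp: set_quads)

text \<open>In the absence of a conditional command, a failing test writes the old entry back;
  tables therefore only grow.\<close>

definition update :: "nat \<Rightarrow> expr \<Rightarrow> cmd" where
  "update t e = Put (addr t 9 10 11 12) (Cond e (Num 1) (tab t 9 10 11 12))"

text \<open>The outer four loops only serve to repeat the update \<open>M\<^sup>4\<close> times, once for each possible element
  of the table. The arguments of the relation are the variables 9 to 12, the variables 5 to 8 being those of
  the outer loops.\<close>

definition saturate :: "nat \<Rightarrow> expr \<Rightarrow> cmd" where
  "saturate t e = For4 (For4 (update t e))"

definition table :: "int \<Rightarrow> nat \<Rightarrow> (nat \<Rightarrow> int) \<Rightarrow> nat \<Rightarrow> quad set" where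
  "table X M m t = {p \<in> set (quads M). rel X M m t p}"

text \<open>Addresses below \<open>X + reg_bound\<close> contain the input and the relocated copy of
  its low part; the tables lie above them.\<close>

definition frame :: "int \<Rightarrow> nat \<Rightarrow> nat \<Rightarrow> (nat \<Rightarrow> int) \<Rightarrow> (nat \<Rightarrow> int) \<Rightarrow> bool" where
  "frame X M t m m' \<longleftrightarrow> (\<forall>k. int k < X + int reg_bound \<longrightarrow> m' k = m k) \<and>
     (\<forall>t'. t' \<noteq> t \<longrightarrow> table X M m' t' = table X M m t')"

lemma frame_trans: "frame X M t m m' \<Longrightarrow> frame X M t m' m'' \<Longrightarrow> frame X M t m m''"
  unfolding frame_def by auto

lemma frame_refl: "frame X M t m m"
  unfolding frame_def by auto

lemma run_update:
  fixes m :: "nat \<Rightarrow> int" and e :: expr and t :: nat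
  assumes "length vs = 9" "vs ! 3 = X" "0 \<le> X" "p \<in> set (quads M)"
  defines "m' \<equiv> run M (vs @ quad_list p) (update t e) m"
  shows "frame X M t m m'"
    "table X M m' t = (if sat M m (vs @ quad_list p) e then insert p (table X M m t) else table X M m t)"
proof -
  obtain a b c d where p: "p = (a, b, c, d)" by (cases p) auto
  let ?vs = "vs @ quad_list p"
  have nth: "?vs ! 3 = X" "?vs ! 9 = a" "?vs ! 10 = b" "?vs ! 11 = c" "?vs ! 12 = d"
    using assms(1,2) by (simp_all add: p nth_append)
  have ad: "den M m ?vs (addr t 9 10 11 12) = slot X M t p"
    using den_addr[of ?vs 9 10 11 12 M m t] nth assms(1) by (simp add: p)
  have ge: "X + int reg_bound \<le> slot X M t p" using slot_ge[OF assms(4)] .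
  have m': "m' = (if sat M m ?vs e then m(nat (slot X M t p) := 1) else m)"
    unfolding m'_def update_def tab_def using ad ge assms(3) by (simp add: sat_def)
  have rel: "rel X M m' t' q \<longleftrightarrow> rel X M m t' q \<or> (sat M m ?vs e \<and> t' = t \<and> q = p)"
    if "q \<in> set (quads M)" for t' q
  proof (cases "sat M m ?vs e \<and> t' = t \<and> q = p")
    case True
    then show ?thesis using ge assms(3) by (simp add: m' rel_def)
  next
    case False
    have "nat (slot X M t' q) \<noteq> nat (slot X M t p)" if "\<not> (t' = t \<and> q = p)"
      using slot_inj[of X M t' q t p] slot_ge[OF \<open>q \<in> set (quads M)\<close>, of X t'] ge assms(3,4) that
        \<open>q \<in> set (quads M)\<close> by (auto simp: nat_eq_iff)
    then show ?thesis using False by (auto simp: m' rel_def)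
  qed
  have "m' k = m k" if "int k < X + int reg_bound" for k
    using that ge assms(3) by (auto simp: m' split: if_splits)
  then show "frame X M t m m'" unfolding frame_def table_def using rel by auto
  show "table X M m' t = (if sat M m ?vs e then insert p (table X M m t) else table X M m t)"
    unfolding table_def using rel assms(4) by auto
qed

text \<open>The last two claims describe the final table as the least set closed under
  \<open>F\<close> within the quadruples. \<open>ds\<close> stands for the outer loop counters,
  which may not influence the truth of \<open>e\<close>.\<close>

lemma saturate_correct:
  assumes vs: "length vs = 5" "vs ! 3 = X" "0 \<le> X" and empty: "table X M m t = {}" and F: "mono F"
    and sat: "\<And>m' ds p. length ds = 4 \<Longrightarrow> p \<in> set (quads M) \<Longrightarrow> frame X M t m m' \<Longrightarrow>
      sat M m' (vs @ ds @ quad_list p) e \<longleftrightarrow> p \<in> F (table X M m' t)"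
  defines "m1 \<equiv> run M vs (saturate t e) m"
  shows "frame X M t m m1" "set (quads M) \<inter> F (table X M m1 t) \<subseteq> table X M m1 t"
    "set (quads M) \<inter> F L \<subseteq> L \<Longrightarrow> table X M m1 t \<subseteq> L"
proof -
  have upd: "frame X M t m (run M (vs @ ds @ quad_list p) (update t e) m')"
    "table X M (run M (vs @ ds @ quad_list p) (update t e) m') t = step F p (table X M m' t)"
    if "length ds = 4" "p \<in> set (quads M)" "frame X M t m m'" for ds p m'
    using run_update[where vs = "vs @ ds" and X = X and p = p and M = M and m = m' and t = t and e = e] sat[OF that] that vs frame_trans
    by (auto simp: nth_append step_def)
  have inner: "frame X M t m (fold (\<lambda>p. run M (vs @ ds @ quad_list p) (update t e)) ps m') \<and>
    table X M (fold (\<lambda>p. run M (vs @ ds @ quad_list p) (update t e)) ps m') t = fold (step F) ps (table X M m' t)"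
    if "length ds = 4" "set ps \<subseteq> set (quads M)" "frame X M t m m'" for ds ps m'
    using that
  proof (induction ps arbitrary: m')
    case (Cons p ps)
    then show ?case using upd[of ds p m'] by simp
  qed simp
  define f where "f q = run M (vs @ quad_list q) (For4 (update t e))" for q
  have f: "f q = fold (\<lambda>p. run M (vs @ quad_list q @ quad_list p) (update t e)) (quads M)" for q
    by (intro ext) (simp add: f_def run_For4 del: run.simps)
  have outer: "frame X M t m (fold f qs m') \<and>
     table X M (fold f qs m') t = (fold (step F) (quads M) ^^ length qs) (table X M m' t)"
    if "frame X M t m m'" for qs m'
    using that
  proof (induction qs arbitrary: m')
    case (Cons q qs)
    have "length (quad_list q) = 4" by (cases q) auto
    then show ?case using inner[of "quad_list q" "quads M" m'] Cons by (simp add: f funpow_swap1)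
  qed simp
  have "f = (\<lambda>q. run M (vs @ quad_list q) (For4 (update t e)))"
    by (intro ext) (simp only: f_def)
  then have m1: "m1 = fold f (quads M) m"
    unfolding m1_def saturate_def by (simp only: run_For4[of M vs])
  have T: "table X M m1 t = (fold (step F) (quads M) ^^ length (quads M)) {}"
    using outer[OF frame_refl, of "quads M"] by (simp add: m1 empty)
  show "frame X M t m m1" using outer[OF frame_refl] by (simp add: m1)
  \<comment> \<open>The number of rounds is the length of \<open>quads M\<close>, which is at least
    the number of quadruples.\<close>
  note closed = iterate_closed[OF F card_length, of "quads M"]
  show "set (quads M) \<inter> F (table X M m1 t) \<subseteq> table X M m1 t"
    "set (quads M) \<inter> F L \<subseteq> L \<Longrightarrow> table X M m1 t \<subseteq> L"
    unfolding T using closed by blast+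
qed

section \<open>The tables of the algorithm\<close>

text \<open>Since \<open>M = n + 1\<close>, summing \<open>x\<close> over the range and subtracting
  it once gives \<open>x * n\<close>; so \<open>a\<close> is the input address of the matrix entry.
  If it falls below \<open>reg_bound\<close>, the entry is found in the copy at offset
  \<open>X\<close>.\<close>

definition adj_expr :: expr where
  "adj_expr = (let a = Plus (Num 3) (Plus (Minus (SumM (Var 9)) (Var 9)) (Var 10)) in
     Cond (Minus (Num (int reg_bound)) a) (Mem (Plus (Var 3) a)) (Mem a))"

text \<open>Binary relations occupy quaternary tables, the last two arguments being ignored.\<close>

abbreviation H_tab :: "nat \<Rightarrow> nat \<Rightarrow> expr" where "H_tab x y \<equiv> tab 0 x y x y"
abbreviation D_tab :: "nat \<Rightarrow> nat \<Rightarrow> expr" where "D_tab x y \<equiv> tab 2 x y x y"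

definition H_expr :: expr where
  "H_expr = EAnd (ELess (Var 9) (Var 0)) (EAnd (ELess (Var 10) (Var 0))
     (EAnd (ENot (EEq (Var 9) (Var 10))) (ENot adj_expr)))"

definition G_expr :: expr where
  "G_expr = EAnd (H_tab 11 12) (EOr (EAnd (EEq (Var 9) (Var 11)) (EEq (Var 10) (Var 12)))
     (EEx (EOr (EAnd (tab 1 9 10 11 13) (ENot (H_tab 13 12))) (EAnd (tab 1 9 10 13 12) (ENot (H_tab 13 11))))))"

text \<open>The first disjunct adds the bottom element \<open>n\<close>, so the table contains
  \<open>D'\<close>. In the second, variables 13 and 14 are the candidate leader and 15 and 16 a
  competitor.\<close>

definition D_expr :: expr where
  "D_expr = EOr (EAnd (EEq (Var 9) (Var 0)) (ELess (Var 10) (Var 0)))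
     (EEx (EEx (EAnd (ELess (Var 13) (Var 14)) (EAnd (tab 1 13 14 9 10)
       (ENot (EEx (EEx (EAnd (ELess (Var 15) (Var 16))
         (EAnd (EOr (ELess (Var 15) (Var 13)) (EAnd (EEq (Var 15) (Var 13)) (ELess (Var 16) (Var 14))))
           (EOr (tab 1 13 14 15 16) (tab 1 13 14 16 15)))))))))))"

text \<open>To be read inside \<open>S_expr\<close>: 13, 14 are the old cut, 9, 10 the new one, 16
  is the vertex being counted and 17 a common upper bound of the new cut.\<close>

definition block_expr :: expr where
  "block_expr = EAnd (D_tab 13 16) (EAnd (D_tab 14 16)
     (ENot (EEx (EAnd (D_tab 9 17) (EAnd (D_tab 10 17) (ENot (D_tab 16 17)))))))"

text \<open>Variable 15 is the previous count of whichever colour receives the block.\<close>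

definition S_expr :: expr where
  "S_expr = EOr (EAnd (EEq (Var 9) (Var 0)) (EAnd (EEq (Var 10) (Var 0))
       (EAnd (EEq (Var 11) (Num 0)) (EEq (Var 12) (Num 0)))))
     (EEx (EEx (EAnd (D_tab 13 9) (EAnd (D_tab 13 10) (EAnd (D_tab 14 9) (EAnd (D_tab 14 10)
       (EEx (let s = Plus (Var 15) (SumM (Cond block_expr (Num 1) (Num 0))) in
         EOr (EAnd (tab 3 13 14 15 12) (EEq (Var 11) s)) (EAnd (tab 3 13 14 11 15) (EEq (Var 12) s))))))))))"

definition answer_expr :: expr where
  "answer_expr = EAnd (ENot (ELess (Var 1) (Num 0))) (EAnd (ENot (ELess (Var 2) (Num 0)))
     (EEx (EEx (EEx (EEx (EAnd (tab 3 5 6 7 8)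
       (EAnd (ENot (ELess (Var 7) (Var 1))) (ENot (ELess (Var 8) (Var 2))))))))))"

definition tables_cmd :: cmd where
  "tables_cmd = CSeq (saturate 0 H_expr) (CSeq (saturate 1 G_expr) (CSeq (saturate 2 D_expr) (saturate 3 S_expr)))"

section \<open>Correctness of the four tables\<close>

lemma in_table:
  "{a, b, c, d} \<subseteq> {0..<int M} \<Longrightarrow> rel X M m t (a, b, c, d) \<longleftrightarrow> (a, b, c, d) \<in> table X M m t"
  unfolding table_def set_quads by auto

text \<open>The range \<open>{0..<M}\<close> must include \<open>n\<close>, both as bottom element
  and as the largest count. The condition on \<open>adj_expr\<close> covers every memory that agrees
  with \<open>m0\<close> below the tables, as these change while the program runs.\<close>

locale perm_instance = two_orders +
  fixes M :: nat and X b w :: int and m0 :: "nat \<Rightarrow> int"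
  assumes M: "int M = n + 1"
    and X: "0 \<le> X"
    and adj: "\<And>x y ds c d. x \<in> {0..<n} \<Longrightarrow> y \<in> {0..<n} \<Longrightarrow> x \<noteq> y \<Longrightarrow> length ds = 4 \<Longrightarrow>
      (\<And>k. int k < X + int reg_bound \<Longrightarrow> m k = m0 k) \<Longrightarrow>
      sat M m ([n, b, w, X, int M] @ ds @ [x, y, c, d]) adj_expr \<longleftrightarrow> \<not> H x y"
    and fresh: "\<And>t. table X M m0 t = {}"
begin

abbreviation vs where "vs \<equiv> [n, b, w, X, int M]"

abbreviation Qd where "Qd \<equiv> set (quads M)"

lemma vs_simps: "length vs = 5" "vs ! 3 = X"
  by simp_all

lemma ds_cases:
  assumes "length ds = (4::nat)" obtains d1 d2 d3 d4 where "ds = [d1, d2, d3, d4]"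
  using assms by (auto simp: numeral_eq_Suc length_Suc_conv)

definition H_set :: "quad set" where "H_set = {(x, y, c, d). H x y}"
definition D_set :: "quad set" where "D_set = {(x, y, c, d). D' x y}"
definition G_set :: "quad set" where "G_set = {(p, q, a, b). G p q a b}"
definition S_set :: "quad set" where "S_set = {(u, v, i, j). S u v i j}"

lemma H_lookup:
  assumes "table X M m 0 = Qd \<inter> H_set" "{x, y} \<subseteq> {0..<int M}"
  shows "rel X M m 0 (x, y, x, y) \<longleftrightarrow> H x y"
  using in_table[of x y x y M X m 0] assms by (auto simp: set_quads H_set_def)

lemma G_lookup:
  assumes "table X M m 1 = Qd \<inter> G_set" "{p, q, x, y} \<subseteq> {0..<int M}"
  shows "rel X M m 1 (p, q, x, y) \<longleftrightarrow> G p q x y"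
  using in_table[of p q x y M X m 1] assms by (auto simp: set_quads G_set_def)

lemma D_lookup:
  assumes "table X M m 2 = Qd \<inter> D_set" "{x, y} \<subseteq> {0..<int M}"
  shows "rel X M m 2 (x, y, x, y) \<longleftrightarrow> D' x y"
  using in_table[of x y x y M X m 2] assms by (auto simp: set_quads D_set_def)

lemma S_lookup:
  assumes "table X M m 3 = Qd \<inter> S_set" "{u, v, i, j} \<subseteq> {0..<int M}"
  shows "rel X M m 3 (u, v, i, j) \<longleftrightarrow> S u v i j"
  using in_table[of u v i j M X m 3] assms by (auto simp: set_quads S_set_def)

lemma H_stage:
  defines "m1 \<equiv> run M vs (saturate 0 H_expr) m0"
  shows "frame X M 0 m0 m1" "table X M m1 0 = Qd \<inter> H_set"
proof -
  have sat: "sat M m' (vs @ ds @ quad_list p) H_expr \<longleftrightarrow> p \<in> H_set"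
    if "length ds = 4" "p \<in> Qd" "frame X M 0 m0 m'" for m' ds p
  proof -
    note asm = that
    obtain x y c d where p: "p = (x, y, c, d)" by (cases p) auto
    obtain d1 d2 d3 d4 where ds: "ds = [d1, d2, d3, d4]" by (rule ds_cases[OF asm(1)])
    have 1: "sat M m' (vs @ ds @ quad_list p) H_expr \<longleftrightarrow>
        x < n \<and> y < n \<and> x \<noteq> y \<and> \<not> sat M m' (vs @ ds @ [x, y, c, d]) adj_expr"
      by (simp add: H_expr_def sat_simps p ds)
    have "x \<in> {0..<n} \<Longrightarrow> y \<in> {0..<n} \<Longrightarrow> x \<noteq> y \<Longrightarrow>
        sat M m' (vs @ ds @ [x, y, c, d]) adj_expr \<longleftrightarrow> \<not> H x y"
      using adj[of x y ds m'] that(1,3) unfolding frame_def by simp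
    moreover have "0 \<le> x" "0 \<le> y" using that(2) by (auto simp: p set_quads)
    moreover have "H x y \<Longrightarrow> x \<in> V \<and> y \<in> V \<and> x \<noteq> y" using H_V H_irrefl by blast
    ultimately show ?thesis unfolding 1 by (auto simp: H_set_def p)
  qed
  \<comment> \<open>\<open>H\<close> is not recursive: the operator is constant, and its least
    closed set is the relation itself.\<close>
  have mono: "mono (\<lambda>_::quad set. H_set)" by (simp add: mono_def)
  note c = saturate_correct[OF vs_simps X fresh[of 0] mono sat, folded m1_def]
  show "frame X M 0 m0 m1" using c(1) .
  have "Qd \<inter> H_set \<subseteq> table X M m1 0" using c(2) .
  moreover have "table X M m1 0 \<subseteq> Qd \<inter> H_set" using c(3)[of "Qd \<inter> H_set"] by simp
  ultimately show "table X M m1 0 = Qd \<inter> H_set" by blast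
qed

definition G_op :: "quad set \<Rightarrow> quad set" where
  "G_op R = {(p, q, a, b). H a b \<and> (p = a \<and> q = b \<or>
     (\<exists>c\<in>{0..<int M}. (p, q, a, c) \<in> R \<and> \<not> H c b \<or> (p, q, c, b) \<in> R \<and> \<not> H c a))}"

lemma H_dom: "H x y \<Longrightarrow> {x, y} \<subseteq> {0..<int M}"
  using H_V[of x y] M by auto

text \<open>Leastness gives one inclusion; closure together with rule induction on \<open>G\<close>
  gives the other. All vertices involved lie in the range, so the bounded quantifier in
  \<open>G_op\<close> suffices.\<close>

lemma G_stage:
  assumes H: "table X M m 0 = Qd \<inter> H_set" and empty: "table X M m 1 = {}"
  defines "m1 \<equiv> run M vs (saturate 1 G_expr) m"
  shows "frame X M 1 m m1" "table X M m1 1 = Qd \<inter> G_set"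
proof -
  have sat: "sat M m' (vs @ ds @ quad_list p) G_expr \<longleftrightarrow> p \<in> G_op (table X M m' 1)"
    if "length ds = 4" "p \<in> Qd" "frame X M 1 m m'" for m' ds p
  proof -
    note asm = that
    obtain p1 q1 x y where p: "p = (p1, q1, x, y)" by (cases p) auto
    obtain d1 d2 d3 d4 where ds: "ds = [d1, d2, d3, d4]" by (rule ds_cases[OF asm(1)])
    have "table X M m' 0 = Qd \<inter> H_set" using that(3) H unfolding frame_def by auto
    note H' = H_lookup[OF this]
    have r: "p1 \<in> {0..<int M}" "q1 \<in> {0..<int M}" "x \<in> {0..<int M}" "y \<in> {0..<int M}"
      using that(2) by (auto simp: p set_quads)
    show ?thesis using r
      by (simp add: G_expr_def G_op_def sat_simps sat_tab p ds H' in_table[where t = 1] del: One_nat_def cong: conj_cong)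
  qed
  have mono: "mono G_op" unfolding G_op_def by (intro monoI) blast
  note c = saturate_correct[OF vs_simps X empty mono sat, folded m1_def]
  show "frame X M 1 m m1" using c(1) .
  have G_dom: "(p, q, a, b) \<in> Qd" if "G p q a b" for p q a b
    using G_H[OF that] H_dom[of p q] H_dom[of a b] by (auto simp: set_quads)
  have "table X M m1 1 \<subseteq> G_set"
  proof (rule c(3))
    show "Qd \<inter> G_op G_set \<subseteq> G_set"
      unfolding G_op_def G_set_def using G.intros by blast
  qed
  moreover have "(p, q, a, b) \<in> table X M m1 1" if "G p q a b" for p q a b
    using that
  proof (induction rule: G.induct)
    case (G_refl p q)
    then show ?case using c(2) G_dom[OF G.G_refl[OF G_refl]] by (auto simp: G_op_def)
  next
    case (G_head p q a d b)
    have "(p, q, a, b) \<in> Qd" using G_dom[OF G.G_head[OF G_head.hyps]] .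
    moreover have "d \<in> {0..<int M}" using G_dom[OF G_head.hyps(1)] by (auto simp: set_quads)
    ultimately show ?case using c(2) G_head by (auto simp: G_op_def)
  next
    case (G_tail p q d b a)
    have "(p, q, a, b) \<in> Qd" using G_dom[OF G.G_tail[OF G_tail.hyps]] .
    moreover have "d \<in> {0..<int M}" using G_dom[OF G_tail.hyps(1)] by (auto simp: set_quads)
    ultimately show ?case using c(2) G_tail by (auto simp: G_op_def)
  qed
  then have "Qd \<inter> G_set \<subseteq> table X M m1 1" unfolding G_set_def by auto
  moreover have "table X M m1 1 \<subseteq> Qd" unfolding table_def by auto
  ultimately show "table X M m1 1 = Qd \<inter> G_set" by blast
qed

text \<open>Restricting the quantifiers to the range is harmless because \<open>G\<close> relates
  only pairs of vertices.\<close>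

lemma D'_iff:
  assumes "{x, y} \<subseteq> {0..<int M}"
  shows "D' x y \<longleftrightarrow> x = n \<and> y < n \<or> (\<exists>p\<in>{0..<int M}. \<exists>q\<in>{0..<int M}. p < q \<and> G p q x y \<and>
    \<not> (\<exists>c\<in>{0..<int M}. \<exists>d\<in>{0..<int M}. c < d \<and> (c < p \<or> c = p \<and> d < q) \<and> (G p q c d \<or> G p q d c)))"
proof -
  have G_dom: "a \<in> {0..<int M}" "b \<in> {0..<int M}" "p \<in> {0..<int M}" "q \<in> {0..<int M}" if "G p q a b" for p q a b
    using G_H[OF that] H_dom[of p q] H_dom[of a b] by auto
  have "leader p q \<longleftrightarrow> p < q \<and>
    \<not> (\<exists>c\<in>{0..<int M}. \<exists>d\<in>{0..<int M}. c < d \<and> (c < p \<or> c = p \<and> d < q) \<and> (G p q c d \<or> G p q d c))" for p q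
    unfolding leader_def lex_def using G_dom[of p q] by blast
  then have "D x y \<longleftrightarrow> (\<exists>p\<in>{0..<int M}. \<exists>q\<in>{0..<int M}. p < q \<and> G p q x y \<and>
    \<not> (\<exists>c\<in>{0..<int M}. \<exists>d\<in>{0..<int M}. c < d \<and> (c < p \<or> c = p \<and> d < q) \<and> (G p q c d \<or> G p q d c)))"
    unfolding D_def using G_dom[of _ _ x y] by blast
  then show ?thesis using assms unfolding D'_def by auto
qed

lemma D_stage:
  assumes G: "table X M m 1 = Qd \<inter> G_set" and empty: "table X M m 2 = {}"
  defines "m1 \<equiv> run M vs (saturate 2 D_expr) m"
  shows "frame X M 2 m m1" "table X M m1 2 = Qd \<inter> D_set"
proof -
  have sat: "sat M m' (vs @ ds @ quad_list p) D_expr \<longleftrightarrow> p \<in> D_set"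
    if "length ds = 4" "p \<in> Qd" "frame X M 2 m m'" for m' ds p
  proof -
    note asm = that
    obtain x y c d where p: "p = (x, y, c, d)" by (cases p) auto
    obtain d1 d2 d3 d4 where ds: "ds = [d1, d2, d3, d4]" by (rule ds_cases[OF asm(1)])
    have "table X M m' 1 = Qd \<inter> G_set" using that(3) G unfolding frame_def by auto
    note G' = G_lookup[OF this]
    have r: "{x, y} \<subseteq> {0..<int M}" using that(2) by (auto simp: p set_quads)
    then have "p \<in> D_set \<longleftrightarrow> D' x y" "x \<in> {0..<int M}" "y \<in> {0..<int M}" by (auto simp: D_set_def p)
    then show ?thesis unfolding D'_iff[OF r]
      by (simp add: D_expr_def sat_simps sat_tab p ds G' del: One_nat_def cong: conj_cong)
  qed
  have mono: "mono (\<lambda>_::quad set. D_set)" by (simp add: mono_def)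
  note c = saturate_correct[OF vs_simps X empty mono sat, folded m1_def]
  show "frame X M 2 m m1" using c(1) .
  have "Qd \<inter> D_set \<subseteq> table X M m1 2" using c(2) .
  moreover have "table X M m1 2 \<subseteq> Qd \<inter> D_set" using c(3)[of "Qd \<inter> D_set"] by simp
  ultimately show "table X M m1 2 = Qd \<inter> D_set" by blast
qed

definition S_op :: "quad set \<Rightarrow> quad set" where
  "S_op R = {(u', v', i', j'). u' = n \<and> v' = n \<and> i' = 0 \<and> j' = 0 \<or>
     (\<exists>u\<in>{0..<int M}. \<exists>v\<in>{0..<int M}. D' u u' \<and> D' u v' \<and> D' v u' \<and> D' v v' \<and>
       (\<exists>i\<in>{0..<int M}. (u, v, i, j') \<in> R \<and> i' = i + int (card (block u v u' v')) \<or>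
          (u, v, i', i) \<in> R \<and> j' = i + int (card (block u v u' v'))))}"

lemma S_stage:
  assumes D: "table X M m 2 = Qd \<inter> D_set" and empty: "table X M m 3 = {}"
  defines "m1 \<equiv> run M vs (saturate 3 S_expr) m"
  shows "frame X M 3 m m1" "table X M m1 3 = Qd \<inter> S_set"
proof -
  have sat: "sat M m' (vs @ ds @ quad_list p) S_expr \<longleftrightarrow> p \<in> S_op (table X M m' 3)"
    if "length ds = 4" "p \<in> Qd" "frame X M 3 m m'" for m' ds p
  proof -
    note asm = that
    obtain u' v' i' j' where p: "p = (u', v', i', j')" by (cases p) auto
    obtain d1 d2 d3 d4 where ds: "ds = [d1, d2, d3, d4]" by (rule ds_cases[OF asm(1)])
    have "table X M m' 2 = Qd \<inter> D_set" using that(3) D unfolding frame_def by auto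
    note D' = D_lookup[OF this]
    have r: "u' \<in> {0..<int M}" "v' \<in> {0..<int M}" "i' \<in> {0..<int M}" "j' \<in> {0..<int M}"
      using that(2) by (auto simp: p set_quads)
    \<comment> \<open>Upper bounds are vertices, so the bounded quantifier over them in
      \<open>block_expr\<close> misses none.\<close>
    have dom: "D' x y \<Longrightarrow> y \<in> {0..<int M}" for x y
      using D'_V[of x y] M by auto
    have "{z \<in> {0..<int M}. sat M m' (vs @ ds @ [u', v', i', j', u, v, i, z]) block_expr} = block u v u' v'"
      if "u \<in> {0..<int M}" "v \<in> {0..<int M}" for u v i
    proof -
      have "sat M m' (vs @ ds @ [u', v', i', j', u, v, i, z]) block_expr \<longleftrightarrow> D' u z \<and> D' v z \<and>
          (\<forall>y\<in>{0..<int M}. D' u' y \<and> D' v' y \<longrightarrow> D' z y)" if "z \<in> {0..<int M}" for z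
        using r that \<open>u \<in> _\<close> \<open>v \<in> _\<close> by (simp add: block_expr_def sat_simps sat_tab ds D' cong: conj_cong) blast
      then show ?thesis unfolding block_def using dom by blast
    qed
    note block = this[unfolded ds, simplified]
    show ?thesis using r
      by (simp add: S_expr_def S_op_def sat_simps sat_tab Let_def den_count p ds D' block in_table[where t = 3] del: den.simps(7) cong: conj_cong)
  qed
  have mono: "mono S_op" unfolding S_op_def by (intro monoI) blast
  note c = saturate_correct[OF vs_simps X empty mono sat, folded m1_def]
  show "frame X M 3 m m1" using c(1) .
  have S_dom: "(u, v, i, j) \<in> Qd" if "S u v i j" for u v i j
    using S_range[OF that] M by (auto simp: set_quads)
  have "table X M m1 3 \<subseteq> S_set"
  proof (rule c(3))
    show "Qd \<inter> S_op S_set \<subseteq> S_set"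
    proof
      fix p assume "p \<in> Qd \<inter> S_op S_set"
      moreover obtain u' v' i' j' where p: "p = (u', v', i', j')" by (cases p) auto
      ultimately consider "u' = n" "v' = n" "i' = 0" "j' = 0"
        | u v i where "D' u u'" "D' u v'" "D' v u'" "D' v v'" "S u v i j'" "i' = i + int (card (block u v u' v'))"
        | u v i where "D' u u'" "D' u v'" "D' v u'" "D' v v'" "S u v i' i" "j' = i + int (card (block u v u' v'))"
        by (simp add: S_op_def S_set_def) blast
      then have "S u' v' i' j'"
        by cases (simp_all add: S_init S_black S_white)
      then show "p \<in> S_set" by (simp add: S_set_def p)
    qed
  qed
  moreover have "(u, v, i, j) \<in> table X M m1 3" if "S u v i j" for u v i j
    using that
  proof (induction rule: S.induct)
    case S_init
    have "(n, n, 0, 0) \<in> S_op (table X M m1 3)" by (simp add: S_op_def)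
    then show ?case using c(2) S_dom[OF S.S_init] by blast
  next
    case (S_black u v i j u' v')
    have "(u', v', i + int (card (block u v u' v')), j) \<in> Qd" using S_dom[OF S.S_black[OF S_black.hyps]] .
    moreover have "u \<in> {0..<int M}" "v \<in> {0..<int M}" "i \<in> {0..<int M}"
      using S_dom[OF S_black.hyps(1)] by (auto simp: set_quads)
    then have "(u', v', i + int (card (block u v u' v')), j) \<in> S_op (table X M m1 3)"
      using S_black unfolding S_op_def by blast
    ultimately show ?case using c(2) by blast
  next
    case (S_white u v i j u' v')
    have "(u', v', i, j + int (card (block u v u' v'))) \<in> Qd" using S_dom[OF S.S_white[OF S_white.hyps]] .
    moreover have "u \<in> {0..<int M}" "v \<in> {0..<int M}" "j \<in> {0..<int M}"
      using S_dom[OF S_white.hyps(1)] by (auto simp: set_quads)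
    then have "(u', v', i, j + int (card (block u v u' v'))) \<in> S_op (table X M m1 3)"
      using S_white unfolding S_op_def by blast
    ultimately show ?case using c(2) by blast
  qed
  then have "Qd \<inter> S_set \<subseteq> table X M m1 3" unfolding S_set_def by auto
  moreover have "table X M m1 3 \<subseteq> Qd" unfolding table_def by auto
  ultimately show "table X M m1 3 = Qd \<inter> S_set" by blast
qed

lemma answer_correct:
  "sat M (run M vs tables_cmd m0) vs answer_expr \<longleftrightarrow>
    (\<exists>B W. bw B W \<and> int (card B) = b \<and> int (card W) = w)"
proof -
  define m1 where "m1 = run M vs (saturate 0 H_expr) m0"
  define m2 where "m2 = run M vs (saturate 1 G_expr) m1"
  define m3 where "m3 = run M vs (saturate 2 D_expr) m2"
  define m4 where "m4 = run M vs (saturate 3 S_expr) m3"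
  have m4: "run M vs tables_cmd m0 = m4"
    by (simp add: tables_cmd_def m1_def m2_def m3_def m4_def)
  have 1: "frame X M 0 m0 m1" "table X M m1 0 = Qd \<inter> H_set"
    using H_stage by (simp_all add: m1_def)
  then have "table X M m1 t = {}" if "t \<noteq> 0" for t using that fresh by (simp add: frame_def)
  note e1 = this
  have 2: "frame X M 1 m1 m2" "table X M m2 1 = Qd \<inter> G_set"
    using G_stage[OF 1(2) e1] by (simp_all add: m2_def)
  then have e2: "table X M m2 2 = {}" "table X M m2 3 = {}" using e1 by (simp_all add: frame_def)
  have 3: "frame X M 2 m2 m3" "table X M m3 2 = Qd \<inter> D_set"
    using D_stage[OF 2(2) e2(1)] by (simp_all add: m3_def)
  then have e3: "table X M m3 3 = {}" using e2 by (simp add: frame_def)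
  have 4: "table X M m4 3 = Qd \<inter> S_set"
    using S_stage[OF 3(2) e3] by (simp add: m4_def)
  have S_dom: "u \<in> {0..<int M}" "v \<in> {0..<int M}" "i \<in> {0..<int M}" "j \<in> {0..<int M}" if "S u v i j" for u v i j
    using S_range[OF that] M by auto
  have "sat M m4 vs answer_expr \<longleftrightarrow> 0 \<le> b \<and> 0 \<le> w \<and> (\<exists>u\<in>{0..<int M}. \<exists>v\<in>{0..<int M}.
      \<exists>i\<in>{0..<int M}. \<exists>j\<in>{0..<int M}. S u v i j \<and> b \<le> i \<and> w \<le> j)"
    by (simp add: answer_expr_def sat_simps sat_tab S_lookup[OF 4] not_less cong: conj_cong)
  also have "\<dots> \<longleftrightarrow> (\<exists>u v i j. S u v i j \<and> b \<le> i \<and> w \<le> j) \<and> 0 \<le> b \<and> 0 \<le> w"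
    using S_dom by blast
  finally show ?thesis unfolding m4 S_iff .
qed

end

section \<open>The program\<close>

text \<open>A common point has the same height on both segments, hence the same parameter
  \<open>u\<close>, and convex combination preserves the strict order of the end points.\<close>

lemma segments_disjoint:
  fixes a b c d :: real
  assumes "a < b" "c < d"
  shows "closed_segment (a, 1) (c, 0) \<inter> closed_segment (b, 1) (d, 0 :: real) = {}"
proof -
  have "(1 - u) * a + u * c \<noteq> (1 - u) * b + u * d" if "0 \<le> u" "u \<le> 1" for u
  proof (cases "u = 0")
    case False
    then have "u * c < u * d" "(1 - u) * a \<le> (1 - u) * b" using assms that by (auto intro: mult_left_mono)
    then show ?thesis by linarith
  qed (use assms in simp)
  then show ?thesis by (auto simp: closed_segment_def)
qed

lemma segments_cross:
  fixes a b c d :: real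
  assumes "a < b" "d < c"
  shows "closed_segment (a, 1) (c, 0) \<inter> closed_segment (b, 1) (d, 0 :: real) \<noteq> {}"
proof -
  \<comment> \<open>Solves \<open>(1 - u) * a + u * c = (1 - u) * b + u * d\<close>.\<close>
  define u where "u = (b - a) / ((b - a) + (c - d))"
  have u: "0 \<le> u" "u \<le> 1" using assms by (auto simp: u_def)
  have "u * ((b - a) + (c - d)) = b - a" using assms by (simp add: u_def)
  then have "(1 - u) * a + u * c = (1 - u) * b + u * d" by (simp add: algebra_simps)
  then have "((1 - u) * a + u * c, 1 - u) \<in> closed_segment (a, 1) (c, 0) \<inter> closed_segment (b, 1) (d, 0)"
    using u by (auto simp: closed_segment_def)
  then show ?thesis by blast
qed

lemma segments_meet_iff:
  assumes "p i \<noteq> p j" "q i \<noteq> q j"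
  shows "diagram_segment p q i \<inter> diagram_segment p q j = {} \<longleftrightarrow> (p i < p j \<longleftrightarrow> q i < q j)"
  using segments_disjoint[of "p i" "p j" "q i" "q j"] segments_disjoint[of "p j" "p i" "q j" "q i"]
    segments_cross[of "p i" "p j" "q j" "q i"] segments_cross[of "p j" "p i" "q i" "q j"] assms
  unfolding diagram_segment_def by (smt (verit) Int_commute)

lemma permutation_graph_orders:
  assumes "permutation_graph ({..<n}, E)"
  obtains P Q where "two_orders (int n) P Q"
    "\<And>i j. i < n \<Longrightarrow> j < n \<Longrightarrow> i \<noteq> j \<Longrightarrow> {i, j} \<in> E \<longleftrightarrow> \<not> two_orders.H (int n) P Q (int i) (int j)"
proof -
  obtain n' p q f where pq: "inj_on p {1..n'}" "inj_on q {1..n'}" and f: "bij_betw f {..<n} {1..n'}"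
    and iso: "\<And>u v. u < n \<Longrightarrow> v < n \<Longrightarrow> {u, v} \<in> E \<longleftrightarrow>
      {f u, f v} \<in> {{i, j} | i j. i \<in> {1..n'} \<and> j \<in> {1..n'} \<and> i \<noteq> j \<and>
        diagram_segment p q i \<inter> diagram_segment p q j \<noteq> {}}"
    using assms unfolding permutation_graph_def permutation_diagram_def graph_iso_def diagram_graph_def
    by auto
  define P where "P x = p (f (nat x))" for x :: int
  define Q where "Q x = q (f (nat x))" for x :: int
  have nat: "inj_on nat {0..<int n}" "nat ` {0..<int n} = {..<n}"
    by (auto simp: inj_on_def image_iff intro!: bexI[of _ "int _"])
  have inj: "inj_on (\<lambda>x. f (nat x)) {0..<int n}" "(\<lambda>x. f (nat x)) ` {0..<int n} = {1..n'}"
    using comp_inj_on[of nat _ f] nat f unfolding bij_betw_def by (simp_all add: comp_def flip: image_image)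
  interpret two_orders "int n" P Q
  proof
    show "inj_on P {0..<int n}" "inj_on Q {0..<int n}"
      using comp_inj_on[OF inj(1)] pq inj(2) unfolding P_def Q_def comp_def by auto
  qed simp
  have "{i, j} \<in> E \<longleftrightarrow> \<not> H (int i) (int j)" if ij: "i < n" "j < n" "i \<noteq> j" for i j
  proof -
    have fi: "f i \<in> {1..n'}" "f j \<in> {1..n'}" "f i \<noteq> f j"
      using bij_betw_apply[OF f] inj_on_eq_iff[OF bij_betw_imp_inj_on[OF f], of i j] ij by simp_all
    then have ne: "p (f i) \<noteq> p (f j)" "q (f i) \<noteq> q (f j)"
      using inj_on_eq_iff[OF pq(1) fi(1,2)] inj_on_eq_iff[OF pq(2) fi(1,2)] by simp_all
    have "{i, j} \<in> E \<longleftrightarrow> diagram_segment p q (f i) \<inter> diagram_segment p q (f j) \<noteq> {}"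
      unfolding iso[OF ij(1,2)] mem_Collect_eq doubleton_eq_iff using fi by (metis Int_commute)
    also have "\<dots> \<longleftrightarrow> \<not> (p (f i) < p (f j) \<longleftrightarrow> q (f i) < q (f j))"
      using segments_meet_iff[of p "f i" "f j" q, OF ne] by simp
    also have "\<dots> \<longleftrightarrow> \<not> H (int i) (int j)"
      using ij ne unfolding H_def T_def P_def Q_def by auto
    finally show ?thesis .
  qed
  with two_orders_axioms show thesis using that by blast
qed

section \<open>Layout of the encoded instance\<close>

lemma nth_concat_blocks:
  assumes "\<And>i. i < m \<Longrightarrow> length (g i) = n" "i < m" "j < n"
  shows "concat (map g [0..<m]) ! (i * n + j) = g i ! j"
  using assms
proof (induction m)
  case (Suc m)
  have len: "length (concat (map g [0..<m])) = m * n"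
  proof -
    have "map (length \<circ> g) [0..<m] = replicate m n"
      using Suc.prems(1) by (intro nth_equalityI) auto
    then show ?thesis by (simp add: length_concat comp_def sum_list_replicate)
  qed
  show ?case
  proof (cases "i < m")
    case True
    have "i * n + j < Suc i * n" using Suc.prems(3) by simp
    also have "\<dots> \<le> m * n" using True by (intro mult_le_mono1) simp
    finally show ?thesis using Suc True by (simp add: nth_append len)
  next
    case False
    then have "i = m" using Suc.prems(2) by simp
    then show ?thesis using Suc.prems by (simp add: nth_append len)
  qed
qed simp

lemma length_encode_instance: "length (encode_instance (n, E, b, w)) = 3 + n * n"
  by (simp add: encode_instance_def length_concat comp_def sum_list_triv)

lemma ram_input_params:
  "ram_input (encode_instance (n, E, b, w)) 0 = int n"
  "ram_input (encode_instance (n, E, b, w)) 1 = b"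
  "ram_input (encode_instance (n, E, b, w)) 2 = w"
  unfolding ram_input_def length_encode_instance by (simp_all add: encode_instance_def)

lemma ram_input_entry:
  assumes "i < n" "j < n"
  shows "ram_input (encode_instance (n, E, b, w)) (3 + (i * n + j)) = (if {i, j} \<in> E then 1 else 0)"
proof -
  have "i * n + j < Suc i * n" using assms by simp
  also have "\<dots> \<le> n * n" using assms by (intro mult_le_mono1) simp
  finally have "i * n + j < n * n" .
  moreover have "encode_instance (n, E, b, w) ! (3 + (i * n + j)) =
      concat (map (\<lambda>i. map (\<lambda>j. if {i, j} \<in> E then 1 else 0) [0..<n]) [0..<n]) ! (i * n + j)"
    by (simp add: encode_instance_def numeral_3_eq_3)
  ultimately show ?thesis
    unfolding ram_input_def length_encode_instance
    using nth_concat_blocks[of n "\<lambda>i. map (\<lambda>j. if {i, j} \<in> E then 1 else 0) [0..<n]" n i j] assms by simp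
qed

lemma ram_input_beyond: "3 + n * n \<le> k \<Longrightarrow> ram_input (encode_instance (n, E, b, w)) k = 0"
  unfolding ram_input_def length_encode_instance by simp

lemma ram_input_bit:
  assumes "3 \<le> k" shows "ram_input (encode_instance (n, E, b, w)) k \<in> {0, 1}"
proof (cases "k < 3 + n * n")
  case True
  then have "n > 0" by (cases n) (use assms in auto)
  define i j where "i = (k - 3) div n" and "j = (k - 3) mod n"
  have "k = 3 + (i * n + j)" "i < n" "j < n"
    using True assms \<open>n > 0\<close> by (simp_all add: i_def j_def less_mult_imp_div_less)
  then show ?thesis using ram_input_entry[of i n j E b w] by auto
next
  case False
  then show ?thesis using ram_input_beyond by simp
qed

section \<open>Relocation of the low registers\<close>

fun effect :: "ram_com \<Rightarrow> ram_state \<Rightarrow> ram_state" where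
  "effect (Const r c) s = s(r := c)"
| "effect (Add r i j) s = s(r := s i + s j)"
| "effect (Store i r) s = s(nat (s i) := s r)"
| "effect _ s = s"

fun straight :: "ram_com \<Rightarrow> bool" where
  "straight (Const r c) = True"
| "straight (Add r i j) = True"
| "straight (Store i r) = True"
| "straight _ = False"

fun seqs :: "ram_com list \<Rightarrow> ram_com" where
  "seqs [] = Skip"
| "seqs (c # cs) = Seq c (seqs cs)"

lemma exec_straight: "straight c \<Longrightarrow> ram_exec c s 1 (effect c s)"
  by (cases c) (simp_all add: ram_exec.Const ram_exec.Add ram_exec.Store del: One_nat_def)

lemma exec_seqs:
  "list_all straight cs \<Longrightarrow> ram_exec (seqs cs) s (length cs + 1) (fold effect cs s)"
proof (induction cs arbitrary: s)
  case Nil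
  then show ?case using ram_exec.Skip by simp
next
  case (Cons c cs)
  then have "ram_exec (Seq c (seqs cs)) s (1 + (length cs + 1)) (fold effect cs (effect c s))"
    by (intro ram_exec.Seq[OF exec_straight]) auto
  then show ?case by simp
qed

text \<open>Register 3 holds the offset \<open>X\<close> and register 4 serves as scratch for the
  address.\<close>

definition copy_reg :: "nat \<Rightarrow> ram_com list" where
  "copy_reg k = [Const 4 (int k), Add 4 3 4, Store 4 k]"

lemma copy_regs:
  assumes "s 3 = int X" "reg_bound \<le> X" "set ks \<subseteq> {5<..<reg_bound}" "a \<noteq> 4"
  shows "fold effect (concat (map copy_reg ks)) s a = (if X \<le> a \<and> a - X \<in> set ks then s (a - X) else s a)"
  using assms(1,3)
proof (induction ks arbitrary: s)
  case (Cons k ks)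
  define s' where "s' = fold effect (copy_reg k) s"
  have s': "s' a = (if a = X + k then s k else s a)" if "a \<noteq> 4" for a
    using Cons.prems that assms(2) by (auto simp: s'_def copy_reg_def nat_add_distrib)
  have "s' 3 = int X" using s'[of 3] Cons.prems assms(2) by (auto simp: reg_bound_def)
  then have "fold effect (concat (map copy_reg ks)) s' a =
      (if X \<le> a \<and> a - X \<in> set ks then s' (a - X) else s' a)"
    using Cons.IH[of s'] Cons.prems by auto
  moreover have "s' (a - X) = s (a - X)" if "a - X \<in> set ks"
    using s'[of "a - X"] that Cons.prems(2) assms(2) by auto
  ultimately show ?case using s'[OF assms(4)] assms(2)
    by (auto simp: s'_def)
qed simp

text \<open>The first two instructions turn the square of \<open>n\<close> in register 3 into
  \<open>X\<close>. After the copying, register 6 is free and is used to write the remembered bits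
  to \<open>X + 4\<close> and \<open>X + 5\<close>; finally register 4 receives
  \<open>M = n + 1\<close>.\<close>

definition boot_tail :: "int \<Rightarrow> int \<Rightarrow> ram_com list" where
  "boot_tail x y = [Const 4 (int reg_bound + 3), Add 3 3 4] @ concat (map copy_reg [6..<reg_bound]) @
     [Const 6 x, Const 4 4, Add 4 3 4, Store 4 6, Const 6 y, Const 4 5, Add 4 3 4, Store 4 6,
      Const 4 1, Add 4 4 0]"

definition boot_branch :: "int \<Rightarrow> int \<Rightarrow> ram_com" where
  "boot_branch x y = Seq (Const 5 1) (Seq (Add 4 0 3)
     (Seq (WhilePos 4 (Seq (Add 3 3 0) (Sub 4 4 5))) (seqs (boot_tail x y))))"

text \<open>Frees the registers below \<^term>\<open>reg_bound\<close>. Register 3 holds the diagonal entry 0, and branching on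
  the bits in registers 4 and 5 keeps their contents in the control state, so that these three registers
  suffice to compute the address \<open>X = n\<^sup>2 + reg_bound + 3\<close> past the input.\<close>

definition boot :: ram_com where
  "boot = IfPos 4 (IfPos 5 (boot_branch 1 1) (boot_branch 1 0)) (IfPos 5 (boot_branch 0 1) (boot_branch 0 0))"

text \<open>Repeated addition replaces multiplication; a round consists of one test and two
  instructions.\<close>

lemma square_loop:
  assumes "s 4 = int k" "s 5 = 1"
  shows "ram_exec (WhilePos 4 (Seq (Add 3 3 0) (Sub 4 4 5))) s (3 * k + 1) (s(3 := s 3 + int k * s 0, 4 := 0))"
  using assms
proof (induction k arbitrary: s)
  case 0
  then have "s(3 := s 3 + int 0 * s 0, 4 := 0) = s" by auto
  then show ?case using ram_exec.WhileFalse[of s 4] 0 by simp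
next
  case (Suc k)
  let ?s1 = "s(3 := s 3 + s 0)"
  let ?s2 = "?s1(4 := ?s1 4 - ?s1 5)"
  have b: "ram_exec (Seq (Add 3 3 0) (Sub 4 4 5)) s (1 + 1) ?s2"
    by (rule ram_exec.Seq[OF ram_exec.Add ram_exec.Sub])
  have l: "ram_exec (WhilePos 4 (Seq (Add 3 3 0) (Sub 4 4 5))) ?s2 (3 * k + 1) (?s2(3 := ?s2 3 + int k * ?s2 0, 4 := 0))"
    using Suc.prems by (intro Suc.IH) auto
  have "s 4 > 0" using Suc.prems by simp
  note ram_exec.WhileTrue[OF this b l]
  moreover have "?s2(3 := ?s2 3 + int k * ?s2 0, 4 := 0) = s(3 := s 3 + int (Suc k) * s 0, 4 := 0)"
    by (auto simp: fun_eq_iff algebra_simps)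
  moreover have "1 + (1 + 1) + (3 * k + 1) = 3 * Suc k + 1" by simp
  ultimately show ?case by metis
qed

text \<open>The 2 added to the time stands for the two branchings in \<open>boot\<close>.\<close>

lemma boot_branch_correct:
  assumes s: "s 0 = int n" "s 3 = 0"
  defines "X \<equiv> n * n + reg_bound + 3"
  shows "\<exists>t s'. ram_exec (boot_branch x y) s t s' \<and> t + 2 = 3 * n + 3 * reg_bound \<and>
    s' 0 = int n \<and> s' 1 = s 1 \<and> s' 2 = s 2 \<and> s' 3 = int X \<and> s' 4 = int n + 1 \<and>
    (\<forall>a\<ge>reg_bound. s' a = (if a = X + 4 then x else if a = X + 5 then y
       else if X + 6 \<le> a \<and> a < X + reg_bound then s (a - X) else s a))"
proof -
  let ?s1 = "s(5 := 1)"
  let ?s2 = "?s1(4 := ?s1 0 + ?s1 3)"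
  let ?s3 = "?s2(3 := ?s2 3 + int n * ?s2 0, 4 := 0)"
  define s4 where "s4 = effect (Add 3 3 4) (effect (Const 4 (int reg_bound + 3)) ?s3)"
  define s5 where "s5 = fold effect (concat (map copy_reg [6..<reg_bound])) s4"
  define s6 where "s6 = fold effect [Const 6 x, Const 4 4, Add 4 3 4, Store 4 6, Const 6 y, Const 4 5,
    Add 4 3 4, Store 4 6, Const 4 1, Add 4 4 0] s5"
  have lp: "ram_exec (WhilePos 4 (Seq (Add 3 3 0) (Sub 4 4 5))) ?s2 (3 * n + 1) ?s3"
    by (rule square_loop) (use s in auto)
  have str: "list_all straight (boot_tail x y)"
    by (simp add: boot_tail_def list_all_iff copy_reg_def)
  have fold: "fold effect (boot_tail x y) ?s3 = s6"
    by (simp add: boot_tail_def s4_def s5_def s6_def del: effect.simps)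
  have len: "length (boot_tail x y) = 3 * reg_bound - 6"
    by (simp add: boot_tail_def length_concat comp_def copy_reg_def sum_list_triv reg_bound_def)
  have "ram_exec (boot_branch x y) s (1 + (1 + ((3 * n + 1) + (length (boot_tail x y) + 1)))) (fold effect (boot_tail x y) ?s3)"
    unfolding boot_branch_def
    by (rule ram_exec.Seq[OF ram_exec.Const ram_exec.Seq[OF ram_exec.Add ram_exec.Seq[OF lp exec_seqs[OF str]]]])
  moreover have "1 + (1 + ((3 * n + 1) + (length (boot_tail x y) + 1))) + 2 = 3 * n + 3 * reg_bound"
    unfolding len by (simp add: reg_bound_def)
  ultimately have ex: "\<exists>t. t + 2 = 3 * n + 3 * reg_bound \<and> ram_exec (boot_branch x y) s t s6"
    unfolding fold by blast
  have s4: "s4 a = (if a = 3 then int X else if a = 5 then 1 else s a)" if "a \<noteq> 4" for a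
    using that s by (auto simp: s4_def X_def)
  have s5: "s5 a = (if X \<le> a \<and> a - X \<in> {6..<reg_bound} then s4 (a - X) else s4 a)" if "a \<noteq> 4" for a
    unfolding s5_def set_upt[symmetric]
    by (rule copy_regs) (use s4[of 3] that in \<open>auto simp: X_def\<close>)
  have X: "100 \<le> X" by (simp add: X_def reg_bound_def)
  have s53: "s5 3 = int X" "s5 0 = int n" using s5[of 3] s4[of 3] s5[of 0] s4[of 0] X s by auto
  have s6: "s6 a = (if a = X + 4 then x else if a = X + 5 then y else if a = 6 then y
      else if a = 4 then int n + 1 else s5 a)" for a
    using X s53 by (auto simp: s6_def nat_add_distrib)
  have "s6 0 = int n \<and> s6 1 = s 1 \<and> s6 2 = s 2 \<and> s6 3 = int X \<and> s6 4 = int n + 1"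
    using X s53 s5[of 1] s5[of 2] s4[of 1] s4[of 2] by (simp add: s6)
  moreover have "s6 a = (if a = X + 4 then x else if a = X + 5 then y
       else if X + 6 \<le> a \<and> a < X + reg_bound then s (a - X) else s a)" if "reg_bound \<le> a" for a
    using that X s5[of a] s4[of a] s4[of "a - X"] by (auto simp: s6 reg_bound_def)
  ultimately show ?thesis using ex by blast
qed


text \<open>Registers 0 to 4 hold \<open>n\<close>, \<open>b\<close>, \<open>w\<close>,
  \<open>X\<close> and \<open>M\<close>, the five variables in scope. The last two instructions move
  the answer from register 5 to register 0.\<close>

definition bw_program :: ram_com where
  "bw_program = Seq boot (Seq (ccomp [0, 1, 2, 3, 4] 5 tables_cmd)
     (Seq (ecomp [0, 1, 2, 3, 4] 5 (Cond answer_expr (Num 1) (Num 0))) (Seq (Const 6 0) (Add 0 5 6))))"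

lemma exec_if:
  "ram_exec (if s i > 0 then c1 else c2) s t s' \<Longrightarrow> ram_exec (IfPos i c1 c2) s (1 + t) s'"
  using ram_exec.IfTrue[of s i c1 t s' c2] ram_exec.IfFalse[of s i c2 t s' c1] by (cases "s i > 0") simp_all

lemma boot_correct:
  assumes s: "s 0 = int n" "s 3 = 0" "s 4 \<in> {0, 1}" "s 5 \<in> {0, 1}"
    and beyond: "\<And>k. 3 + n * n \<le> k \<Longrightarrow> s k = 0"
  defines "X \<equiv> n * n + reg_bound + 3"
  obtains s' where "ram_exec boot s (3 * n + 3 * reg_bound) s'"
    "s' 0 = int n" "s' 1 = s 1" "s' 2 = s 2" "s' 3 = int X" "s' 4 = int n + 1"
    "\<And>k. 3 \<le> k \<Longrightarrow> k < reg_bound \<Longrightarrow> s' (X + k) = s k"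
    "\<And>k. reg_bound \<le> k \<Longrightarrow> k < X \<Longrightarrow> s' k = s k"
    "\<And>k. X + reg_bound \<le> k \<Longrightarrow> s' k = 0"
proof -
  obtain t s' where br: "ram_exec (boot_branch (s 4) (s 5)) s t s'" "t + 2 = 3 * n + 3 * reg_bound"
    and s': "s' 0 = int n" "s' 1 = s 1" "s' 2 = s 2" "s' 3 = int X" "s' 4 = int n + 1"
    and mem: "\<And>a. reg_bound \<le> a \<Longrightarrow> s' a = (if a = X + 4 then s 4 else if a = X + 5 then s 5
       else if X + 6 \<le> a \<and> a < X + reg_bound then s (a - X) else s a)"
    using boot_branch_correct[OF s(1,2), of "s 4" "s 5"] unfolding X_def by blast
  have cases: "s 4 = 0 \<or> s 4 = 1" "s 5 = 0 \<or> s 5 = 1" using s(3,4) by auto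
  have "ram_exec boot s (1 + (1 + t)) s'"
  proof -
    have inner: "ram_exec (IfPos 5 (boot_branch (s 4) 1) (boot_branch (s 4) 0)) s (1 + t) s'"
      by (rule exec_if) (use cases(2) br(1) in auto)
    show ?thesis unfolding boot_def
      by (rule exec_if) (use cases(1) inner in auto)
  qed
  then have "ram_exec boot s (3 * n + 3 * reg_bound) s'" using br(2) by (metis add.assoc add.commute one_add_one)
  moreover have "s' (X + k) = s k" if "3 \<le> k" "k < reg_bound" for k
  proof (cases "k = 3")
    case True
    \<comment> \<open>Address \<open>X + 3\<close> is never written and lies beyond the input, so it
      contains 0, as does the diagonal entry in register 3.\<close>
    then show ?thesis using mem[of "X + 3"] beyond[of "X + 3"] s(2) by (simp add: X_def)
  next
    case False
    then have "k = 4 \<or> k = 5 \<or> 6 \<le> k" using that by linarith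
    then show ?thesis using mem[of "X + k"] that by (auto simp: X_def)
  qed
  moreover have "s' k = s k" if "reg_bound \<le> k" "k < X" for k
    using mem[of k] that by simp
  moreover have "s' k = 0" if "X + reg_bound \<le> k" for k
    using mem[of k] beyond[of k] that by (simp add: X_def reg_bound_def)
  ultimately show thesis using that s' by blast
qed

section \<open>Correctness and running time of the whole program\<close>

lemma poly_nat_mono: "x \<le> y \<Longrightarrow> poly (p :: nat poly) x \<le> poly p y"
  by (induction p) (auto intro!: add_mono mult_mono)

lemma input_size_ge: "length xs \<le> input_size xs"
  by (induction xs) (auto simp: input_size_def)

lemma adj_expr_entry:
  fixes x y :: int
  assumes "x \<in> {0..<int n}" "y \<in> {0..<int n}" "length ds = 4"
    and lowc: "\<And>k. 3 \<le> k \<Longrightarrow> k < reg_bound \<Longrightarrow> m (X + k) = s k"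
    and low: "\<And>k. reg_bound \<le> k \<Longrightarrow> k < X \<Longrightarrow> m k = s k"
    and X: "n * n + 3 \<le> X" "reg_bound \<le> X"
  shows "sat (n + 1) m ([int n, b, w, int X, int (n + 1)] @ ds @ [x, y, c, d]) adj_expr \<longleftrightarrow>
    0 < s (3 + (nat x * n + nat y))"
proof -
  let ?k = "3 + (nat x * n + nat y)"
  obtain d1 d2 d3 d4 where ds: "ds = [d1, d2, d3, d4]"
    using assms(3) by (auto simp: numeral_eq_Suc length_Suc_conv)
  have k: "3 + (x * (int n + 1) - x + y) = int ?k"
    using assms(1,2) by (simp add: algebra_simps)
  have xy: "nat x < n" "nat y < n" using assms(1,2) by auto
  then have "nat x * n + nat y < Suc (nat x) * n" by simp
  also have "\<dots> \<le> n * n" using xy by (intro mult_le_mono1) simp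
  finally have lt: "?k < X" using X by simp
  define a where "a = Plus (Num 3) (Plus (Minus (SumM (Var 9)) (Var 9)) (Var 10))"
  define k where "k = ?k"
  let ?vs = "[int n, b, w, int X, int (n + 1)] @ ds @ [x, y, c, d]"
  have a: "den (n + 1) m ?vs a = int k"
    unfolding k_def k[symmetric] by (simp add: a_def ds algebra_simps)
  have adj: "adj_expr = Cond (Minus (Num (int reg_bound)) a) (Mem (Plus (Var 3) a)) (Mem a)"
    by (simp add: adj_expr_def a_def Let_def)
  have "den (n + 1) m ?vs adj_expr =
     (if int k < int reg_bound then m (nat (int X + int k)) else m (nat (int k)))"
    using X(2) a unfolding adj by simp
  also have "\<dots> = s ?k"
    using lowc[of ?k] low[of ?k] lt unfolding k_def[symmetric] by (simp add: k_def flip: of_nat_add)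
  finally show ?thesis by (simp add: sat_def)
qed

lemma has_bw_coloring_iff:
  assumes "two_orders (int n) P Q"
    and "\<And>i j. i < n \<Longrightarrow> j < n \<Longrightarrow> i \<noteq> j \<Longrightarrow> {i, j} \<in> E \<longleftrightarrow> \<not> two_orders.H (int n) P Q (int i) (int j)"
  shows "has_bw_coloring ({..<n}, E) b w \<longleftrightarrow>
    (\<exists>B W. two_orders.bw (int n) P Q B W \<and> int (card B) = b \<and> int (card W) = w)"
proof -
  interpret two_orders "int n" P Q by fact
  have "bw (int ` B) (int ` W) \<longleftrightarrow> B \<subseteq> {..<n} \<and> W \<subseteq> {..<n} \<and> B \<inter> W = {} \<and> (\<forall>x\<in>B. \<forall>y\<in>W. {x, y} \<notin> E)"
    for B W :: "nat set"
  proof -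
    have "(\<forall>x\<in>B. \<forall>y\<in>W. H (int x) (int y)) \<longleftrightarrow> (\<forall>x\<in>B. \<forall>y\<in>W. {x, y} \<notin> E)"
      if "B \<subseteq> {..<n}" "W \<subseteq> {..<n}" "B \<inter> W = {}"
      using assms(2) that by (metis disjoint_iff lessThan_iff subsetD)
    moreover have "int ` A \<subseteq> V \<longleftrightarrow> A \<subseteq> {..<n}" for A by force
    moreover have "int ` B \<inter> int ` W = {} \<longleftrightarrow> B \<inter> W = {}" by auto
    ultimately show ?thesis unfolding bw_def ball_simps by meson
  qed
  note eq = this
  show ?thesis
  proof
    assume "has_bw_coloring ({..<n}, E) b w"
    then obtain B W where "bw (int ` B) (int ` W)" "int (card B) = b" "int (card W) = w"
      unfolding has_bw_coloring_def using eq by auto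
    then show "\<exists>B W. bw B W \<and> int (card B) = b \<and> int (card W) = w"
      by (intro exI[of _ "int ` B"] exI[of _ "int ` W"]) (simp add: card_image)
  next
    assume "\<exists>B W. bw B W \<and> int (card B) = b \<and> int (card W) = w"
    then obtain B W where BW: "bw B W" "int (card B) = b" "int (card W) = w" by blast
    have "\<exists>B'. B = int ` B' \<and> card B = card B'" if "B \<subseteq> V" for B
    proof -
      have "B = int ` nat ` B" using that by (force simp: image_iff)
      then show ?thesis by (metis card_image inj_on_of_nat)
    qed
    then obtain B' W' where "B = int ` B'" "card B = card B'" "W = int ` W'" "card W = card W'"
      using BW(1) unfolding bw_def by metis
    then show "has_bw_coloring ({..<n}, E) b w"
      using BW eq[of B' W'] unfolding has_bw_coloring_def by auto
  qed
qed

lemma need_tables: "5 + cneed tables_cmd \<le> reg_bound"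
  by (simp add: tables_cmd_def saturate_def update_def tab_def addr_def H_expr_def G_expr_def D_expr_def
      S_expr_def block_expr_def adj_expr_def EAnd_def EOr_def ENot_def ELess_def EEq_def EEx_def Let_def reg_bound_def)

lemma need_answer: "5 + need (Cond answer_expr (Num 1) (Num 0)) \<le> reg_bound"
  by (simp add: answer_expr_def tab_def addr_def EAnd_def ENot_def ELess_def EEx_def reg_bound_def)

lemma bw_program_correct:
  assumes G: "permutation_graph ({..<n}, E)"
  defines "bound \<equiv> 3 * n + 3 * reg_bound + poly (ccost tables_cmd) (n + 1) +
    poly (cost (Cond answer_expr (Num 1) (Num 0))) (n + 1) + 2"
  shows "\<exists>t s. ram_exec bw_program (ram_input (encode_instance (n, E, b, w))) t s \<and> t \<le> bound \<and>
    s 0 = (if has_bw_coloring ({..<n}, E) b w then 1 else 0)"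
proof -
  define s where "s = ram_input (encode_instance (n, E, b, w))"
  define X where "X = n * n + reg_bound + 3"
  let ?env = "[0, 1, 2, 3, 4] :: nat list"
  let ?e = "Cond answer_expr (Num 1) (Num 0)"
  obtain P Q where PQ: "two_orders (int n) P Q"
    and E: "\<And>i j. i < n \<Longrightarrow> j < n \<Longrightarrow> i \<noteq> j \<Longrightarrow> {i, j} \<in> E \<longleftrightarrow> \<not> two_orders.H (int n) P Q (int i) (int j)"
    using permutation_graph_orders[OF G] by blast
  have "E \<subseteq> {{u, v} | u v. u < n \<and> v < n \<and> u \<noteq> v}"
    using G by (auto simp: permutation_graph_def simple_graph_def)
  \<comment> \<open>Absence of loops makes the first matrix entry 0, which lets \<open>boot\<close>
    use register 3 as an initialised accumulator.\<close>
  then have loop: "{0} \<notin> E" by (auto simp: doubleton_eq_iff)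
  have s3: "s 3 = 0"
  proof (cases "n = 0")
    case True
    then show ?thesis using ram_input_beyond[of n 3] by (simp add: s_def)
  next
    case False
    then show ?thesis using ram_input_entry[of 0 n 0 E b w] loop by (simp add: s_def)
  qed
  have beyond: "\<And>k. 3 + n * n \<le> k \<Longrightarrow> s k = 0" unfolding s_def using ram_input_beyond .
  have s0: "s 0 = int n" unfolding s_def using ram_input_params(1) .
  have bits: "s 4 \<in> {0, 1}" "s 5 \<in> {0, 1}" using ram_input_bit unfolding s_def by simp_all
  obtain s1 where boot: "ram_exec boot s (3 * n + 3 * reg_bound) s1"
    and s1: "s1 0 = int n" "s1 1 = s 1" "s1 2 = s 2" "s1 3 = int X" "s1 4 = int n + 1"
    and lowc: "\<And>k. 3 \<le> k \<Longrightarrow> k < reg_bound \<Longrightarrow> s1 (X + k) = s k"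
    and low: "\<And>k. reg_bound \<le> k \<Longrightarrow> k < X \<Longrightarrow> s1 k = s k"
    and high: "\<And>k. X + reg_bound \<le> k \<Longrightarrow> s1 k = 0"
    using boot_correct[OF s0 s3 bits beyond] unfolding X_def by blast
  interpret perm_instance "int n" P Q "n + 1" "int X" b w s1
  proof (intro perm_instance.intro PQ perm_instance_axioms.intro)
    fix x y c d :: int and ds :: "int list" and m :: "nat \<Rightarrow> int"
    assume xy: "x \<in> {0..<int n}" "y \<in> {0..<int n}" "x \<noteq> y" "length ds = 4"
      and m: "\<And>k. int k < int X + int reg_bound \<Longrightarrow> m k = s1 k"
    have "sat (n + 1) m ([int n, b, w, int X, int (n + 1)] @ ds @ [x, y, c, d]) adj_expr \<longleftrightarrow>
        0 < s (3 + (nat x * n + nat y))"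
    proof (rule adj_expr_entry)
      show "m (X + k) = s k" if "3 \<le> k" "k < reg_bound" for k
        using m[of "X + k"] lowc[of k] that by simp
      show "m k = s k" if "reg_bound \<le> k" "k < X" for k
        using m[of k] low[of k] that by simp
    qed (use xy in \<open>auto simp: X_def\<close>)
    also have "\<dots> \<longleftrightarrow> {nat x, nat y} \<in> E"
      unfolding s_def using xy by (subst ram_input_entry) auto
    also have "\<dots> \<longleftrightarrow> \<not> two_orders.H (int n) P Q x y"
    proof -
      have "nat x < n" "nat y < n" "nat x \<noteq> nat y" "int (nat x) = x" "int (nat y) = y"
        using xy by auto
      then show ?thesis using E[of "nat x" "nat y"] by simp
    qed
    finally show "sat (n + 1) m ([int n, b, w, int X, int (n + 1)] @ ds @ [x, y, c, d]) adj_expr \<longleftrightarrow>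
      \<not> two_orders.H (int n) P Q x y" .
  next
    fix t
    \<comment> \<open>All slots start at \<open>X + reg_bound\<close>, where memory is still zero,
      so every table is initially empty.\<close>
    have "s1 (nat (slot (int X) (n + 1) t p)) = 0" if "p \<in> set (quads (n + 1))" for p
      using slot_ge[OF that, of "int X" t] by (intro high) linarith
    then show "table (int X) (n + 1) s1 t = {}" unfolding table_def rel_def by auto
  qed auto
  have env: "env_ok (n + 1) ?env 5 s1 vs"
    using s1 ram_input_params(2,3) by (auto simp: env_ok_def less_Suc_eq numeral_eq_Suc s_def)
  have mem: "same_mem s1 s1" by (simp add: same_mem_def)
  obtain t2 s2 where 2: "ram_exec (ccomp ?env 5 tables_cmd) s1 t2 s2" "t2 \<le> poly (ccost tables_cmd) (n + 1)"
    "below 5 s1 s2" "same_mem s2 (run (n + 1) vs tables_cmd s1)"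
    using ccomp_correct[OF env mem need_tables] by blast
  obtain t3 s3 where 3: "ram_exec (ecomp ?env 5 ?e) s2 t3 s3" "t3 \<le> poly (cost ?e) (n + 1)"
    "s3 5 = den (n + 1) (run (n + 1) vs tables_cmd s1) vs ?e"
    using ecomp_correct[OF env_ok_below[OF env 2(3) order_refl] 2(4) need_answer] by blast
  define s4 where "s4 = (s3(6 := 0))(0 := (s3(6 := 0)) 5 + (s3(6 := 0)) 6)"
  have "ram_exec bw_program s (3 * n + 3 * reg_bound + (t2 + (t3 + (1 + 1)))) s4"
    unfolding bw_program_def s4_def
    by (rule ram_exec.Seq[OF boot ram_exec.Seq[OF 2(1) ram_exec.Seq[OF 3(1) ram_exec.Seq[OF ram_exec.Const ram_exec.Add]]]])
  moreover have "s4 0 = (if has_bw_coloring ({..<n}, E) b w then 1 else 0)"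
  proof -
    have "has_bw_coloring ({..<n}, E) b w \<longleftrightarrow> sat (n + 1) (run (n + 1) vs tables_cmd s1) vs answer_expr"
      unfolding answer_correct by (rule has_bw_coloring_iff[OF PQ E])
    moreover have "s4 0 = s3 5" by (simp add: s4_def)
    ultimately show ?thesis unfolding 3(3) den.simps sat_def by (simp only:)
  qed
  moreover have "3 * n + 3 * reg_bound + (t2 + (t3 + (1 + 1))) \<le> bound" using 2(2) 3(2) unfolding bound_def by linarith
  ultimately show ?thesis unfolding s_def by blast
qed

theorem theorem1:
  shows "\<exists>A. decides_in_poly_time A
           {(n, E, b, w). permutation_graph ({..<n}, E)}
           encode_instance
           (\<lambda>(n, E, b, w). has_bw_coloring ({..<n}, E) b w)"
proof (intro exI[of _ bw_program])
  let ?q = "[:3 * reg_bound + 2, 3:] + ccost tables_cmd + cost (Cond answer_expr (Num 1) (Num 0))"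
  have "\<exists>t s. ram_exec bw_program (ram_input (encode_instance (n, E, b, w))) t s \<and>
      t \<le> poly ?q (input_size (encode_instance (n, E, b, w))) \<and>
      s 0 = (if has_bw_coloring ({..<n}, E) b w then 1 else 0)"
    if G: "permutation_graph ({..<n}, E)" for n E b w
  proof -
    let ?N = "input_size (encode_instance (n, E, b, w))"
    \<comment> \<open>The loop bound \<open>n + 1\<close> is at most the length of the input, so a
      polynomial in it is bounded by the same polynomial in the input size.\<close>
    have "n + 1 \<le> 3 + n * n" by (cases n) auto
    also have "\<dots> \<le> ?N" using input_size_ge[of "encode_instance (n, E, b, w)"] by (simp only: length_encode_instance)
    finally have N: "n + 1 \<le> ?N" .
    have "3 * n + 3 * reg_bound + poly (ccost tables_cmd) (n + 1) +
        poly (cost (Cond answer_expr (Num 1) (Num 0))) (n + 1) + 2 \<le> poly ?q (n + 1)"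
      by (simp del: cost.simps ccost.simps)
    also have "\<dots> \<le> poly ?q ?N" using poly_nat_mono[OF N] .
    finally show ?thesis using bw_program_correct[OF G, of b w] by (meson le_trans)
  qed
  then show "decides_in_poly_time bw_program {(n, E, b, w). permutation_graph ({..<n}, E)} encode_instance
      (\<lambda>(n, E, b, w). has_bw_coloring ({..<n}, E) b w)"
    unfolding decides_in_poly_time_def by (intro exI[of _ ?q]) (auto simp del: poly_add)
qed

end
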